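(* Let $\Gamma$ be a Coxeter graph. Let $A[\hat\Gamma]$ have standard generators $\{\hat\delta_\beta\mid\beta\in\Phi[\Gamma]\}$. Then the map $\hat\delta_\beta\mapsto\delta_\beta$ ($\beta\in\Phi[\Gamma]$) induces an isomorphism $A[\hat\Gamma]\to KVA[\Gamma]$. In particular $KVA[\Gamma]$ is an Artin group, generated by $\{\delta_\beta\mid\beta\in\Phi[\Gamma]\}$.
   Context: A Coxeter matrix on a countable set $S$ is a symmetric matrix $M=(m_{s,t})_{s,t\in S}$ with entries in $\mathbb{N}\cup\{\infty\}$ such that $m_{s,s}=1$ for all $s$ and $m_{s,t}=m_{t,s}\ge 2$ for $s\neq t$; it is encoded by a Coxeter graph $\Gamma$ with vertex set $S$ ($\Gamma$ is called finite if $S$ is finite). For letters $a,b$ and an integer $m\ge 2$, $\Pi_L(a,b,m)$ denotes the alternating word $aba\cdots$ of length $m$ beginning with $a$, and $\Pi_R(b,a,m)$ denotes the alternating word $\cdots aba$ of length $m$ ending with $a$; the same notation denotes the elements these words represent in a group. The Artin group $A[\Gamma]$ is given by the presentation $\langle S\mid \Pi_R(t,s,m_{s,t})=\Pi_R(s,t,m_{s,t})\text{ for } s\neq t,\ m_{s,t}\neq\infty\rangle$, and the Coxeter group $W[\Gamma]$ is the quotient of $A[\Gamma]$ by the relations $s^2=1$, $s\in S$. The virtual Artin group $VA[\Gamma]$ is the group generated by two sets $\{\sigma_s\mid s\in S\}$ and $\{\tau_s\mid s\in S\}$ in bijection with $S$, subject to the following relations, for all $s,t\in S$ with $s\neq t$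 and $m_{s,t}\neq\infty$: (v1) $\Pi_R(\sigma_t,\sigma_s,m_{s,t})=\Pi_R(\sigma_s,\sigma_t,m_{s,t})$; (v2) $\Pi_R(\tau_t,\tau_s,m_{s,t})=\Pi_R(\tau_s,\tau_t,m_{s,t})$, together with $\tau_s^2=1$ for all $s\in S$; (v3) $\Pi_R(\tau_s,\tau_t,m_{s,t}-1)\,\sigma_s=\sigma_r\,\Pi_R(\tau_s,\tau_t,m_{s,t}-1)$, where $r=s$ if $m_{s,t}$ is even and $r=t$ if $m_{s,t}$ is odd. We have homomorphisms $\iota_A:A[\Gamma]\to VA[\Gamma]$, $s\mapsto\sigma_s$; $\iota_W:W[\Gamma]\to VA[\Gamma]$, $s\mapsto\tau_s$; $\pi_K:VA[\Gamma]\to W[\Gamma]$, $\sigma_s\mapsto 1$, $\tau_s\mapsto s$; and $\pi_P:VA[\Gamma]\to W[\Gamma]$, $\sigma_s\mapsto s$, $\tau_s\mapsto s$. Set $KVA[\Gamma]=\ker\pi_K$ and $PVA[\Gamma]=\ker\pi_P$. Let $V$ be the real vector space with basis $\{\alpha_s\mid s\in S\}$ (simple roots), with the canonical symmetric bilinear form $\langle\alpha_s,\alpha_t\rangle=-2\cos(\pi/m_{s,t})$ if $m_{s,t}\neq\infty$ and $=-2$ if $m_{s,t}=\infty$. $W[\Gamma]$ acts faithfully on $V$ by $s(v)=v-\langle v,\alpha_s\rangle\alpha_s$. The root system is $\Phi[\Gamma]=\{w(\alpha_s)\mid w\in W[\Gamma],s\in S\}$. For $\beta\in\Phi[\Gamma]$,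 $r_\beta\in W[\Gamma]$ is the reflection $v\mapsto v-\langle v,\beta\rangle\beta$. For $w\in W[\Gamma]$ and $g\in KVA[\Gamma]$ or $PVA[\Gamma]$ write $w\cdot g=\iota_W(w)g\iota_W(w)^{-1}$. For $\beta\in\Phi[\Gamma]$ choose $w\in W[\Gamma]$, $s\in S$ with $w(\alpha_s)=\beta$ and set $\delta_\beta=w\cdot\sigma_s\in KVA[\Gamma]$ and $\zeta_\beta=w\cdot(\tau_s\sigma_s)\in PVA[\Gamma]$ (these do not depend on the choice of $w,s$). Define the Coxeter matrix $\hat M=(\hat m_{\beta,\gamma})_{\beta,\gamma\in\Phi[\Gamma]}$ by $\hat m_{\beta,\beta}=1$, and for $\beta\neq\gamma$: $\hat m_{\beta,\gamma}=m_{s,t}$ if there exist $w\in W[\Gamma]$, $s,t\in S$ with $\beta=w(\alpha_s)$, $\gamma=w(\alpha_t)$, $m_{s,t}\neq\infty$ (this value is independent of choices), and $\hat m_{\beta,\gamma}=\infty$ otherwise. $\hat\Gamma$ is the Coxeter graph of $\hat M$ (vertex set $\Phi[\Gamma]$). *)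

theory Defs
  imports Complex_Main "HOL-Algebra.Algebra" "HOL-Library.Extended_Nat" "HOL-Library.Countable_Set"
begin

text \<open>A word is a list of letters (g, True) = g and (g, False) = g inverse.\<close>
type_synonym 'g word = "('g \<times> bool) list"

inductive_set pres_rel :: "('g word \<times> 'g word) set \<Rightarrow> ('g word \<times> 'g word) set"
  for R :: "('g word \<times> 'g word) set" where
  refl: "(w, w) \<in> pres_rel R"
| sym: "(u, v) \<in> pres_rel R \<Longrightarrow> (v, u) \<in> pres_rel R"
| trans: "(u, v) \<in> pres_rel R \<Longrightarrow> (v, w) \<in> pres_rel R \<Longrightarrow> (u, w) \<in> pres_rel R"
| cancel: "([(g, b), (g, \<not> b)], []) \<in> pres_rel R"
| rel: "(u, v) \<in> R \<Longrightarrow> (u, v) \<in> pres_rel R"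
| ctx: "(u, v) \<in> pres_rel R \<Longrightarrow> (a @ u @ c, a @ v @ c) \<in> pres_rel R"

definition pres_class :: "('g word \<times> 'g word) set \<Rightarrow> 'g word \<Rightarrow> 'g word set" where
  "pres_class R w = pres_rel R `` {w}"

text \<open>The group with generating set Xg and relations R (R consists of words over Xg).\<close>
definition pres_group :: "'g set \<Rightarrow> ('g word \<times> 'g word) set \<Rightarrow> 'g word set monoid" where
  "pres_group Xg R = \<lparr> carrier = pres_class R ` lists (Xg \<times> UNIV),
      monoid.mult = (\<lambda>A B. pres_class R ((SOME u. u \<in> A) @ (SOME v. v \<in> B))),
      one = pres_class R [] \<rparr>"

definition pres_gen :: "('g word \<times> 'g word) set \<Rightarrow> 'g \<Rightarrow> 'g word set" where
  "pres_gen R g = pres_class R [(g, True)]"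

definition eval_word :: "('b, 'm) monoid_scheme \<Rightarrow> ('g \<Rightarrow> 'b) \<Rightarrow> 'g word \<Rightarrow> 'b" where
  "eval_word G f w = foldr (\<lambda>(g, b) x. (if b then f g else inv\<^bsub>G\<^esub> (f g)) \<otimes>\<^bsub>G\<^esub> x) w \<one>\<^bsub>G\<^esub>"

definition pres_lift :: "'g set \<Rightarrow> ('b, 'm) monoid_scheme \<Rightarrow> ('g \<Rightarrow> 'b) \<Rightarrow> 'g word set \<Rightarrow> 'b" where
  "pres_lift Xg G f x = eval_word G f (SOME w. w \<in> lists (Xg \<times> UNIV) \<and> w \<in> x)"

definition coxeter_matrix :: "'s set \<Rightarrow> ('s \<Rightarrow> 's \<Rightarrow> enat) \<Rightarrow> bool" where
  "coxeter_matrix S M \<longleftrightarrow> (\<forall>s\<in>S. M s s = 1) \<and>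
     (\<forall>s\<in>S. \<forall>t\<in>S. s \<noteq> t \<longrightarrow> M s t = M t s \<and> M s t \<ge> 2)"

fun alt :: "'a \<Rightarrow> 'a \<Rightarrow> nat \<Rightarrow> 'a list" where
  "alt a b 0 = []"
| "alt a b (Suc n) = a # alt b a n"

definition PiR :: "'a \<Rightarrow> 'a \<Rightarrow> nat \<Rightarrow> 'a list" where
  "PiR b a m = rev (alt a b m)"

definition pos :: "'a list \<Rightarrow> 'a word" where
  "pos w = map (\<lambda>x. (x, True)) w"

definition artin_rels :: "'s set \<Rightarrow> ('s \<Rightarrow> 's \<Rightarrow> enat) \<Rightarrow> ('s word \<times> 's word) set" where
  "artin_rels S M = {(pos (PiR t s (the_enat (M s t))), pos (PiR s t (the_enat (M s t)))) | s t.
      s \<in> S \<and> t \<in> S \<and> s \<noteq> t \<and> M s t \<noteq> \<infinity>}"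

definition artin_group :: "'s set \<Rightarrow> ('s \<Rightarrow> 's \<Rightarrow> enat) \<Rightarrow> 's word set monoid" where
  "artin_group S M = pres_group S (artin_rels S M)"

definition coxeter_rels :: "'s set \<Rightarrow> ('s \<Rightarrow> 's \<Rightarrow> enat) \<Rightarrow> ('s word \<times> 's word) set" where
  "coxeter_rels S M = artin_rels S M \<union> {(pos [s, s], []) | s. s \<in> S}"

definition coxeter_group :: "'s set \<Rightarrow> ('s \<Rightarrow> 's \<Rightarrow> enat) \<Rightarrow> 's word set monoid" where
  "coxeter_group S M = pres_group S (coxeter_rels S M)"

section \<open>Virtual Artin groups: Inl s stands for sigma_s, Inr s for tau_s\<close>

definition va_rels :: "'s set \<Rightarrow> ('s \<Rightarrow> 's \<Rightarrow> enat) \<Rightarrow> (('s + 's) word \<times> ('s + 's) word) set" where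
  "va_rels S M =
     map_prod (map (apfst Inl)) (map (apfst Inl)) ` artin_rels S M
   \<union> map_prod (map (apfst Inr)) (map (apfst Inr)) ` artin_rels S M
   \<union> {(pos [Inr s, Inr s], []) | s. s \<in> S}
   \<union> {(pos (PiR (Inr s) (Inr t) (the_enat (M s t) - 1) @ [Inl s]),
        pos (Inl (if even (the_enat (M s t)) then s else t) # PiR (Inr s) (Inr t) (the_enat (M s t) - 1)))
      | s t. s \<in> S \<and> t \<in> S \<and> s \<noteq> t \<and> M s t \<noteq> \<infinity>}"

definition va_gens :: "'s set \<Rightarrow> ('s + 's) set" where
  "va_gens S = Inl ` S \<union> Inr ` S"

definition va_group :: "'s set \<Rightarrow> ('s \<Rightarrow> 's \<Rightarrow> enat) \<Rightarrow> ('s + 's) word set monoid" where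
  "va_group S M = pres_group (va_gens S) (va_rels S M)"

definition sigma :: "'s set \<Rightarrow> ('s \<Rightarrow> 's \<Rightarrow> enat) \<Rightarrow> 's \<Rightarrow> ('s + 's) word set" where
  "sigma S M s = pres_gen (va_rels S M) (Inl s)"

definition tau :: "'s set \<Rightarrow> ('s \<Rightarrow> 's \<Rightarrow> enat) \<Rightarrow> 's \<Rightarrow> ('s + 's) word set" where
  "tau S M s = pres_gen (va_rels S M) (Inr s)"

definition iota_W :: "'s set \<Rightarrow> ('s \<Rightarrow> 's \<Rightarrow> enat) \<Rightarrow> 's word set \<Rightarrow> ('s + 's) word set" where
  "iota_W S M = pres_lift S (va_group S M) (tau S M)"

definition pi_K :: "'s set \<Rightarrow> ('s \<Rightarrow> 's \<Rightarrow> enat) \<Rightarrow> ('s + 's) word set \<Rightarrow> 's word set" where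
  "pi_K S M = pres_lift (va_gens S) (coxeter_group S M)
      (\<lambda>g. case g of Inl s \<Rightarrow> \<one>\<^bsub>coxeter_group S M\<^esub> | Inr s \<Rightarrow> pres_gen (coxeter_rels S M) s)"

definition KVA :: "'s set \<Rightarrow> ('s \<Rightarrow> 's \<Rightarrow> enat) \<Rightarrow> ('s + 's) word set set" where
  "KVA S M = kernel (va_group S M) (coxeter_group S M) (pi_K S M)"

text \<open>Vectors of V are finitely supported functions S -> real; alpha s is the simple root.\<close>
definition alpha :: "'s \<Rightarrow> 's \<Rightarrow> real" where
  "alpha s = (\<lambda>t. if t = s then 1 else 0)"

definition bil_coeff :: "('s \<Rightarrow> 's \<Rightarrow> enat) \<Rightarrow> 's \<Rightarrow> 's \<Rightarrow> real" where
  "bil_coeff M s t = (case M s t of enat m \<Rightarrow> - 2 * cos (pi / real m) | \<infinity> \<Rightarrow> - 2)"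

definition bil :: "('s \<Rightarrow> 's \<Rightarrow> enat) \<Rightarrow> ('s \<Rightarrow> real) \<Rightarrow> ('s \<Rightarrow> real) \<Rightarrow> real" where
  "bil M u v = (\<Sum>s\<in>{s. u s \<noteq> 0}. \<Sum>t\<in>{t. v t \<noteq> 0}. u s * v t * bil_coeff M s t)"

definition refl_s :: "('s \<Rightarrow> 's \<Rightarrow> enat) \<Rightarrow> 's \<Rightarrow> ('s \<Rightarrow> real) \<Rightarrow> ('s \<Rightarrow> real)" where
  "refl_s M s v = (\<lambda>t. v t - bil M v (alpha s) * alpha s t)"

text \<open>Action of a word s1...sk: s1(s2(...sk(v))) (each generator is an involution).\<close>
definition word_act :: "('s \<Rightarrow> 's \<Rightarrow> enat) \<Rightarrow> 's word \<Rightarrow> ('s \<Rightarrow> real) \<Rightarrow> ('s \<Rightarrow> real)" where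
  "word_act M w v = foldr (\<lambda>(s, b) x. refl_s M s x) w v"

definition wact :: "'s set \<Rightarrow> ('s \<Rightarrow> 's \<Rightarrow> enat) \<Rightarrow> 's word set \<Rightarrow> ('s \<Rightarrow> real) \<Rightarrow> ('s \<Rightarrow> real)" where
  "wact S M x v = word_act M (SOME w. w \<in> lists (S \<times> UNIV) \<and> w \<in> x) v"

definition root_system :: "'s set \<Rightarrow> ('s \<Rightarrow> 's \<Rightarrow> enat) \<Rightarrow> ('s \<Rightarrow> real) set" where
  "root_system S M = {wact S M w (alpha s) | w s. w \<in> carrier (coxeter_group S M) \<and> s \<in> S}"

definition delta :: "'s set \<Rightarrow> ('s \<Rightarrow> 's \<Rightarrow> enat) \<Rightarrow> ('s \<Rightarrow> real) \<Rightarrow> ('s + 's) word set" where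
  "delta S M \<beta> = (SOME d. \<exists>w\<in>carrier (coxeter_group S M). \<exists>s\<in>S. wact S M w (alpha s) = \<beta> \<and>
      d = iota_W S M w \<otimes>\<^bsub>va_group S M\<^esub> sigma S M s \<otimes>\<^bsub>va_group S M\<^esub> inv\<^bsub>va_group S M\<^esub> (iota_W S M w))"

definition hat_M :: "'s set \<Rightarrow> ('s \<Rightarrow> 's \<Rightarrow> enat) \<Rightarrow> ('s \<Rightarrow> real) \<Rightarrow> ('s \<Rightarrow> real) \<Rightarrow> enat" where
  "hat_M S M \<beta> \<gamma> =
    (if \<beta> = \<gamma> then 1
     else if (\<exists>w\<in>carrier (coxeter_group S M). \<exists>s\<in>S. \<exists>t\<in>S.
                \<beta> = wact S M w (alpha s) \<and> \<gamma> = wact S M w (alpha t) \<and> M s t \<noteq> \<infinity>)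
     then (SOME m. \<exists>w\<in>carrier (coxeter_group S M). \<exists>s\<in>S. \<exists>t\<in>S.
                \<beta> = wact S M w (alpha s) \<and> \<gamma> = wact S M w (alpha t) \<and> M s t \<noteq> \<infinity> \<and> m = M s t)
     else \<infinity>)"

end

theory Submission
  imports Defs
begin

text \<open>
  The elements \<open>\<delta>\<^sub>\<beta>\<close> are well defined because an element \<open>w\<close> of the Coxeter group with
  \<open>w(\<alpha>\<^sub>s) = \<alpha>\<^sub>p\<close> is a product of dihedral elements, each carrying a simple root to a simple root;
  relation (v3) says exactly that these conjugate the corresponding \<open>\<sigma>\<close>s into each other. The
  factorization follows by induction on the length of \<open>w\<close> from the positivity of roots. Conjugating
  (v1) yields the homomorphism from the Artin group of the roots, and \<open>VA = \<langle>\<delta>\<^sub>\<beta>\<rangle> \<iota>(W)\<close> shows that its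
  image is the kernel of \<open>\<pi>\<^sub>K\<close>. For injectivity, \<open>VA\<close> acts on the underlying set of the Artin group of
  the roots, \<open>\<sigma>\<^sub>s\<close> by left multiplication with the generator of \<open>\<alpha>\<^sub>s\<close> and \<open>\<tau>\<^sub>s\<close> by permuting the
  generators; then \<open>\<delta>\<^sub>\<beta>\<close> acts as left multiplication by the generator of \<open>\<beta>\<close>.
\<close>

section \<open>Groups given by presentations\<close>

text \<open>Why positivity forces the factorization: an element \<open>w\<close> is split as
  \<open>v\<close> times an alternating word of length \<open>k\<close> in \<open>s\<close> and
  \<open>t\<close>, where \<open>v\<close> sends both simple roots to nonnegative vectors. Then
  \<open>w\<close> sends \<open>alpha s\<close> to a combination of these two vectors with
  coefficients sin ((k + 1) \<theta>) / sin \<theta> and sin (k \<theta>) / sin \<theta>, \<theta> =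
  pi / m (or k + 1 and k if m is infinite). A simple root spans an extremal ray of the nonnegative
  cone, so the coefficients cannot both be positive; hence k = m - 1, and the alternating word is
  the one in (v3). A recurring obstacle: \<open>pres_rel\<close> lives on words over the whole type,
  so a derivation between words over the generators may pass through foreign letters. Every map out
  of a presented group has to be extended to them, by the identity, by deletion or by a trivial
  action. The action behind injectivity is defined on words and shown to respect the relations in
  both arguments. Evaluated at the empty word, it recovers a word over the roots up to the Artin
  relations, which avoids constructing a semidirect product.\<close>

declare in_listsD [rule del] in_listsI [rule del]

lemma pres_rel_append:
  assumes "(u, u') \<in> pres_rel R" and "(v, v') \<in> pres_rel R"
  shows "(u @ v, u' @ v') \<in> pres_rel R"
  using pres_rel.ctx[OF assms(1), of "[]" v] pres_rel.ctx[OF assms(2), of u' "[]"]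
  by (auto intro: pres_rel.trans)

text \<open>Used with \<open>k = Inr\<close>, which turns Coxeter words into tau words, and with
  \<open>k\<close> a reflection permuting the roots.\<close>

lemma pres_rel_map:
  assumes "(u, v) \<in> pres_rel R"
    and "\<And>u v. (u, v) \<in> R \<Longrightarrow> (map (apfst k) u, map (apfst k) v) \<in> pres_rel R'"
  shows "(map (apfst k) u, map (apfst k) v) \<in> pres_rel R'"
  using assms(1)
proof induction
  case (cancel g b)
  show ?case using pres_rel.cancel[of "k g" b R'] by simp
next
  case (ctx u v a c)
  then show ?case using pres_rel.ctx[of "map (apfst k) u" "map (apfst k) v" R' "map (apfst k) a" "map (apfst k) c"]
    by simp
qed (auto intro: pres_rel.intros assms(2))

lemma pres_class_eq_iff: "pres_class R u = pres_class R v \<longleftrightarrow> (u, v) \<in> pres_rel R"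
  unfolding pres_class_def by (auto intro: pres_rel.intros)

lemma self_in_pres_class: "u \<in> pres_class R u"
  by (simp add: pres_class_def pres_rel.refl)

definition inv_word :: "'g word \<Rightarrow> 'g word" where
  "inv_word w = rev (map (apsnd Not) w)"

lemma inv_word_Nil [simp]: "inv_word [] = []"
  by (simp add: inv_word_def)

lemma inv_word_inv_word [simp]: "inv_word (inv_word w) = w"
  by (induction w) (auto simp: inv_word_def rev_map)

lemma inv_word_in_lists: "w \<in> lists (Xg \<times> UNIV) \<Longrightarrow> inv_word w \<in> lists (Xg \<times> UNIV)"
  by (force simp: inv_word_def in_lists_conv_set)

lemma append_inv_word: "(w @ inv_word w, []) \<in> pres_rel R"
proof (induction w)
  case (Cons x w)
  obtain g b where x: "x = (g, b)" by force
  have "([x] @ (w @ inv_word w) @ [(g, \<not> b)], [x] @ [] @ [(g, \<not> b)]) \<in> pres_rel R"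
    using Cons by (rule pres_rel.ctx)
  then show ?case using pres_rel.cancel[of g b R]
    by (auto simp: x inv_word_def intro: pres_rel.trans)
qed (simp add: pres_rel.refl)

lemma inv_word_append_cancel: "(inv_word w @ w, []) \<in> pres_rel R"
  using append_inv_word[of "inv_word w"] by simp

text \<open>The product is formed from representatives picked by choice, which may contain letters
  outside \<open>Xg\<close>. This does no harm because \<open>pres_rel\<close> is a congruence on
  all words.\<close>

lemma pres_mult: "pres_class R u \<otimes>\<^bsub>pres_group Xg R\<^esub> pres_class R v = pres_class R (u @ v)"
proof -
  have "(u, SOME x. x \<in> pres_class R u) \<in> pres_rel R" for u
    using someI[of "\<lambda>x. x \<in> pres_class R u", OF self_in_pres_class] by (simp add: pres_class_def)
  then have "pres_class R ((SOME x. x \<in> pres_class R u) @ (SOME x. x \<in> pres_class R v)) = pres_class R (u @ v)"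
    unfolding pres_class_eq_iff by (auto intro: pres_rel_append pres_rel.sym)
  then show ?thesis by (simp add: pres_group_def)
qed

lemma pres_one: "\<one>\<^bsub>pres_group Xg R\<^esub> = pres_class R []"
  by (simp add: pres_group_def)

lemma pres_carrier: "carrier (pres_group Xg R) = pres_class R ` lists (Xg \<times> UNIV)"
  by (simp add: pres_group_def)

lemma pres_class_in_carrier: "w \<in> lists (Xg \<times> UNIV) \<Longrightarrow> pres_class R w \<in> carrier (pres_group Xg R)"
  by (simp add: pres_carrier)

lemma group_pres_group: "group (pres_group Xg R)"
proof -
  have rep: "\<exists>w \<in> lists (Xg \<times> UNIV). x = pres_class R w" if "x \<in> carrier (pres_group Xg R)" for x
    using that by (auto simp: pres_carrier)
  show ?thesis
  proof (rule groupI)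
    fix x y assume "x \<in> carrier (pres_group Xg R)" "y \<in> carrier (pres_group Xg R)"
    then show "x \<otimes>\<^bsub>pres_group Xg R\<^esub> y \<in> carrier (pres_group Xg R)"
      using rep[of x] rep[of y] by (auto simp: pres_mult intro!: pres_class_in_carrier)
  next
    fix x y z
    assume "x \<in> carrier (pres_group Xg R)" "y \<in> carrier (pres_group Xg R)" "z \<in> carrier (pres_group Xg R)"
    then show "x \<otimes>\<^bsub>pres_group Xg R\<^esub> y \<otimes>\<^bsub>pres_group Xg R\<^esub> z =
        x \<otimes>\<^bsub>pres_group Xg R\<^esub> (y \<otimes>\<^bsub>pres_group Xg R\<^esub> z)"
      using rep[of x] rep[of y] rep[of z] by (auto simp: pres_mult)
  next
    fix x assume "x \<in> carrier (pres_group Xg R)"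
    then obtain w where w: "w \<in> lists (Xg \<times> UNIV)" "x = pres_class R w"
      using rep by blast
    show "\<one>\<^bsub>pres_group Xg R\<^esub> \<otimes>\<^bsub>pres_group Xg R\<^esub> x = x"
      by (simp add: w pres_mult pres_one)
    show "\<exists>y\<in>carrier (pres_group Xg R). y \<otimes>\<^bsub>pres_group Xg R\<^esub> x = \<one>\<^bsub>pres_group Xg R\<^esub>"
      by (rule bexI[of _ "pres_class R (inv_word w)"])
        (simp_all add: w pres_mult pres_one pres_class_eq_iff inv_word_append_cancel
          pres_class_in_carrier inv_word_in_lists)
  qed (simp add: pres_one pres_class_in_carrier)
qed

lemma pres_inv:
  assumes "w \<in> lists (Xg \<times> UNIV)"
  shows "inv\<^bsub>pres_group Xg R\<^esub> (pres_class R w) = pres_class R (inv_word w)"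
proof -
  interpret group "pres_group Xg R" by (rule group_pres_group)
  show ?thesis
    by (rule inv_equality)
      (auto simp: pres_mult pres_one pres_class_eq_iff inv_word_append_cancel
        intro!: pres_class_in_carrier inv_word_in_lists assms)
qed

section \<open>Evaluation of words in a group and the universal property of a presentation\<close>

lemma eval_word_Nil [simp]: "eval_word G f [] = \<one>\<^bsub>G\<^esub>"
  by (simp add: eval_word_def)

lemma eval_word_Cons [simp]:
  "eval_word G f ((g, b) # w) = (if b then f g else inv\<^bsub>G\<^esub> (f g)) \<otimes>\<^bsub>G\<^esub> eval_word G f w"
  by (simp add: eval_word_def)

lemma eval_word_map: "eval_word G f (map (apfst k) w) = eval_word G (\<lambda>x. f (k x)) w"
  by (induction w) auto

lemma eval_word_cong:
  assumes "w \<in> lists (Xg \<times> UNIV)" and "\<And>x. x \<in> Xg \<Longrightarrow> f x = f' x"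
  shows "eval_word G f w = eval_word G f' w"
  using assms(1) by (induction w) (auto simp: assms(2))

context group
begin

lemma eval_word_closed:
  assumes "f \<in> Xg \<rightarrow> carrier G" and "w \<in> lists (Xg \<times> UNIV)"
  shows "eval_word G f w \<in> carrier G"
  using assms(2,1) by (induction w) (auto simp: Pi_iff)

lemma eval_word_append:
  assumes "f \<in> Xg \<rightarrow> carrier G" and "u \<in> lists (Xg \<times> UNIV)" and "v \<in> lists (Xg \<times> UNIV)"
  shows "eval_word G f (u @ v) = eval_word G f u \<otimes> eval_word G f v"
  using assms(2)
proof (induction u)
  case (Cons x u)
  obtain g b where x: "x = (g, b)" by force
  have "eval_word G f u \<in> carrier G" "eval_word G f v \<in> carrier G" "f g \<in> carrier G"
    using eval_word_closed[OF assms(1)] Cons assms(1,3) x by auto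
  then show ?case using Cons by (simp add: x m_assoc)
qed (simp add: eval_word_closed[OF assms(1,3)])

text \<open>The evaluated words form the image of a lifted homomorphism, so this turns its
  surjectivity into a statement about a generated subgroup.\<close>

lemma generate_eq_eval_word:
  assumes "f \<in> Xg \<rightarrow> carrier G"
  shows "generate G (f ` Xg) = eval_word G f ` lists (Xg \<times> UNIV)"
proof (rule subset_antisym; rule subsetI)
  fix x assume "x \<in> generate G (f ` Xg)"
  then show "x \<in> eval_word G f ` lists (Xg \<times> UNIV)"
  proof induction
    case one
    show ?case by (rule image_eqI[of _ _ "[]"]) auto
  next
    case (incl h)
    then obtain g where "g \<in> Xg" "h = f g" by blast
    then show ?case using assms by (intro image_eqI[of _ _ "[(g, True)]"]) (auto simp: Pi_iff)
  next
    case (inv h)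
    then obtain g where "g \<in> Xg" "h = f g" by blast
    then show ?case using assms by (intro image_eqI[of _ _ "[(g, False)]"]) (auto simp: Pi_iff)
  next
    case (eng h1 h2)
    then obtain u v where "u \<in> lists (Xg \<times> UNIV)" "h1 = eval_word G f u"
      "v \<in> lists (Xg \<times> UNIV)" "h2 = eval_word G f v" by blast
    then show ?case using assms by (intro image_eqI[of _ _ "u @ v"]) (auto simp: eval_word_append)
  qed
next
  fix x assume "x \<in> eval_word G f ` lists (Xg \<times> UNIV)"
  then obtain w where "w \<in> lists (Xg \<times> UNIV)" "x = eval_word G f w" by blast
  moreover from this(1) have "eval_word G f w \<in> generate G (f ` Xg)"
    by (induction w) (auto simp: generate.incl generate.inv generate.one intro!: generate.eng)
  ultimately show "x \<in> generate G (f ` Xg)" by simp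
qed

text \<open>Conjugation is a homomorphism, so the generators decide. Applied later to the elements
  tau_s, which permute the elements \<open>delta S M \<beta>\<close>.\<close>

lemma generate_conj_closed:
  assumes "D \<subseteq> carrier G" and "a \<in> carrier G" and "\<And>d. d \<in> D \<Longrightarrow> a \<otimes> d \<otimes> inv a \<in> generate G D"
    and "g \<in> generate G D"
  shows "a \<otimes> g \<otimes> inv a \<in> generate G D"
  using assms(4)
proof induction
  case (inv h)
  then have "h \<in> carrier G" using assms(1) by blast
  then have "a \<otimes> inv h \<otimes> inv a = inv (a \<otimes> h \<otimes> inv a)" using assms(2) by (simp add: inv_mult_group m_assoc)
  then show ?case using generate_m_inv_closed[OF assms(1)] assms(3)[OF inv] by simp
next
  case (eng h1 h2)
  then have "h1 \<in> carrier G" "h2 \<in> carrier G" using generate_in_carrier assms(1) by blast+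
  then have "a \<otimes> (h1 \<otimes> h2) \<otimes> inv a = (a \<otimes> h1 \<otimes> inv a) \<otimes> (a \<otimes> h2 \<otimes> inv a)"
    using assms(2) by (simp add: m_assoc flip: m_assoc[of "inv a" a])
  then show ?case using eng by (simp add: generate.eng)
qed (use assms in \<open>auto intro: generate.one\<close>)

lemma eval_word_pres_rel:
  assumes f: "f \<in> Xg \<rightarrow> carrier G" and R: "R \<subseteq> lists (Xg \<times> UNIV) \<times> lists (Xg \<times> UNIV)"
    and rel: "\<And>u v. (u, v) \<in> R \<Longrightarrow> eval_word G f u = eval_word G f v"
    and uv: "(u, v) \<in> pres_rel R" "u \<in> lists (Xg \<times> UNIV)" "v \<in> lists (Xg \<times> UNIV)"
  shows "eval_word G f u = eval_word G f v"
proof -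
  \<comment> \<open>A derivation may pass through letters outside \<open>Xg\<close>; these are sent to the identity.\<close>
  define f' where "f' x = (if x \<in> Xg then f x else \<one>)" for x
  have f': "f' \<in> UNIV \<rightarrow> carrier G" using f by (auto simp: f'_def)
  have eq: "eval_word G f' w = eval_word G f w" if "w \<in> lists (Xg \<times> UNIV)" for w
    using that by (rule eval_word_cong) (simp add: f'_def)
  have "eval_word G f' u = eval_word G f' v"
    using uv(1)
  proof induction
    case (cancel g b)
    show ?case using f' by (cases b) (auto simp: Pi_iff)
  next
    case (rel u v)
    then have "u \<in> lists (Xg \<times> UNIV)" "v \<in> lists (Xg \<times> UNIV)" using R by auto
    then show ?case using assms(3)[OF rel] eq by simp
  next
    case (ctx u v a c)
    then show ?case by (simp add: eval_word_append[OF f'])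
  qed auto
  then show ?thesis using eq uv by simp
qed

lemma pres_lift_class:
  assumes "f \<in> Xg \<rightarrow> carrier G" and "R \<subseteq> lists (Xg \<times> UNIV) \<times> lists (Xg \<times> UNIV)"
    and "\<And>u v. (u, v) \<in> R \<Longrightarrow> eval_word G f u = eval_word G f v"
    and w: "w \<in> lists (Xg \<times> UNIV)"
  shows "pres_lift Xg G f (pres_class R w) = eval_word G f w"
proof -
  define w' where "w' = (SOME u. u \<in> lists (Xg \<times> UNIV) \<and> u \<in> pres_class R w)"
  have w': "w' \<in> lists (Xg \<times> UNIV) \<and> w' \<in> pres_class R w"
    unfolding w'_def by (rule someI[of _ w]) (simp add: w self_in_pres_class)
  then have "eval_word G f w = eval_word G f w'"
    using w by (intro eval_word_pres_rel[OF assms(1-3)]) (auto simp: pres_class_def)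
  then show ?thesis by (simp add: pres_lift_def w'_def)
qed

lemma pres_lift_hom:
  assumes "f \<in> Xg \<rightarrow> carrier G" and "R \<subseteq> lists (Xg \<times> UNIV) \<times> lists (Xg \<times> UNIV)"
    and "\<And>u v. (u, v) \<in> R \<Longrightarrow> eval_word G f u = eval_word G f v"
  shows "pres_lift Xg G f \<in> hom (pres_group Xg R) G"
proof (rule homI)
  fix x assume "x \<in> carrier (pres_group Xg R)"
  then obtain w where "w \<in> lists (Xg \<times> UNIV)" "x = pres_class R w"
    by (auto simp: pres_carrier)
  then show "pres_lift Xg G f x \<in> carrier G"
    by (simp add: pres_lift_class[OF assms] eval_word_closed[OF assms(1)])
next
  fix x y assume "x \<in> carrier (pres_group Xg R)" "y \<in> carrier (pres_group Xg R)"
  then obtain u v where uv: "u \<in> lists (Xg \<times> UNIV)" "v \<in> lists (Xg \<times> UNIV)"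
    and xy: "x = pres_class R u" "y = pres_class R v"
    by (auto simp: pres_carrier)
  then have "u @ v \<in> lists (Xg \<times> UNIV)" by simp
  then show "pres_lift Xg G f (x \<otimes>\<^bsub>pres_group Xg R\<^esub> y) = pres_lift Xg G f x \<otimes> pres_lift Xg G f y"
    by (simp only: xy pres_mult pres_lift_class[OF assms] uv eval_word_append[OF assms(1)])
qed

lemma pres_lift_gen:
  assumes "f \<in> Xg \<rightarrow> carrier G" and "R \<subseteq> lists (Xg \<times> UNIV) \<times> lists (Xg \<times> UNIV)"
    and "\<And>u v. (u, v) \<in> R \<Longrightarrow> eval_word G f u = eval_word G f v" and "x \<in> Xg"
  shows "pres_lift Xg G f (pres_gen R x) = f x"
  using assms(1,4) by (simp add: pres_gen_def pres_lift_class[OF assms(1-3)] Pi_iff)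

end

lemma eval_word_pres_gen:
  assumes "w \<in> lists (Xg \<times> UNIV)" and "k ` Xg \<subseteq> Y"
  shows "eval_word (pres_group Y R) (\<lambda>x. pres_gen R (k x)) w = pres_class R (map (apfst k) w)"
  using assms(1)
proof (induction w)
  case (Cons x w)
  obtain g b where x: "x = (g, b)" by force
  have "inv\<^bsub>pres_group Y R\<^esub> (pres_class R [(k g, True)]) = pres_class R (inv_word [(k g, True)])"
    using Cons assms(2) x by (intro pres_inv) auto
  then show ?case using Cons
    by (auto simp: x pres_gen_def pres_mult inv_word_def)
qed (simp add: pres_one)

section \<open>Alternating words and the alphabets of the relators\<close>

lemma pos_append [simp]: "pos (u @ v) = pos u @ pos v"
  and pos_Nil [simp]: "pos [] = []"
  and pos_Cons [simp]: "pos (x # u) = (x, True) # pos u"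
  and map_apfst_pos: "map (apfst k) (pos u) = pos (map k u)"
  and map_fst_pos [simp]: "map fst (pos u) = u"
  by (auto simp: pos_def comp_def)

lemma pos_in_lists [simp]: "pos w \<in> lists (Xg \<times> UNIV) \<longleftrightarrow> w \<in> lists Xg"
  by (auto simp: pos_def in_lists_conv_set)

lemma set_alt: "set (alt a b n) \<subseteq> {a, b}"
  by (induction n arbitrary: a b) auto

lemma PiR_in_lists [simp]: "a \<in> Xg \<Longrightarrow> b \<in> Xg \<Longrightarrow> PiR b a n \<in> lists Xg"
  using set_alt[of a b n] by (auto simp: PiR_def in_lists_conv_set)

lemma map_alt: "map k (alt a b n) = alt (k a) (k b) n"
  by (induction n arbitrary: a b) auto

lemma map_PiR: "map k (PiR b a n) = PiR (k b) (k a) n"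
  by (simp add: PiR_def map_alt flip: rev_map)

lemma length_alt [simp]: "length (alt a b n) = n"
  by (induction n arbitrary: a b) auto

lemma length_PiR [simp]: "length (PiR b a n) = n"
  by (simp add: PiR_def)

lemma PiR_Suc: "PiR b a (Suc n) = PiR a b n @ [a]"
  by (simp add: PiR_def)

lemma alt_Suc_end: "alt a b (Suc n) = alt a b n @ [if even n then a else b]"
  by (induction n arbitrary: a b) auto

text \<open>\<open>PiR\<close> has its last letter fixed, so the letter added in front depends on
  the parity. An action by words applies the last letter first, hence computations with it grow the
  word on this side.\<close>

lemma PiR_Suc_front: "PiR b a (Suc n) = (if even n then a else b) # PiR b a n"
  unfolding PiR_def alt_Suc_end by simp

lemma artin_rels_lists: "artin_rels S M \<subseteq> lists (S \<times> UNIV) \<times> lists (S \<times> UNIV)"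
  by (auto simp: artin_rels_def)

lemma coxeter_rels_lists: "coxeter_rels S M \<subseteq> lists (S \<times> UNIV) \<times> lists (S \<times> UNIV)"
  using artin_rels_lists[of S M] by (auto simp: coxeter_rels_def)

lemma map_apfst_in_lists: "w \<in> lists (Xg \<times> UNIV) \<Longrightarrow> k ` Xg \<subseteq> Y \<Longrightarrow> map (apfst k) w \<in> lists (Y \<times> UNIV)"
  by (induction w) auto

lemma va_rels_lists: "va_rels S M \<subseteq> lists (va_gens S \<times> UNIV) \<times> lists (va_gens S \<times> UNIV)"
proof -
  have "(map (apfst k) u, map (apfst k) v) \<in> lists (va_gens S \<times> UNIV) \<times> lists (va_gens S \<times> UNIV)"
    if "(u, v) \<in> artin_rels S M" "k = Inl \<or> k = Inr" for u v k
  proof -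
    have "u \<in> lists (S \<times> UNIV)" "v \<in> lists (S \<times> UNIV)" "k ` S \<subseteq> va_gens S"
      using that artin_rels_lists[of S M] by (auto simp: va_gens_def)
    then show ?thesis by (blast intro: map_apfst_in_lists)
  qed
  moreover have "PiR (Inr s) (Inr t) n \<in> lists (va_gens S)" if "s \<in> S" "t \<in> S" for s t n
    using that by (auto simp: va_gens_def)
  ultimately show ?thesis
    unfolding va_rels_def by (auto simp: va_gens_def)
qed

lemma map_apfst_ident: "map (apfst (\<lambda>v. v)) x = x"
  by (induction x) auto

lemma map_apfst_comp: "map (apfst f) (map (apfst g) x) = map (apfst (\<lambda>v. f (g v))) x"
  by (induction x) auto

lemma artin_relI:
  assumes "s \<in> S" and "t \<in> S" and "s \<noteq> t" and "M s t = enat m"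
  shows "(pos (PiR t s m), pos (PiR s t m)) \<in> artin_rels S M"
  unfolding artin_rels_def using assms by (intro CollectI exI[of _ s] exI[of _ t]) auto

section \<open>The geometric representation\<close>

text \<open>This is the space V. \<open>bil\<close> sums over supports, and an infinite support
  would make such a sum degenerate to 0, so linearity is claimed only here.\<close>

definition vecs :: "'s set \<Rightarrow> ('s \<Rightarrow> real) set" where
  "vecs S = {v. finite {x. v x \<noteq> 0} \<and> {x. v x \<noteq> 0} \<subseteq> S}"

definition act :: "('s \<Rightarrow> 's \<Rightarrow> enat) \<Rightarrow> 's list \<Rightarrow> ('s \<Rightarrow> real) \<Rightarrow> 's \<Rightarrow> real" where
  "act M ws v = foldr (refl_s M) ws v"

lemma act_Nil [simp]: "act M [] v = v"
  and act_Cons [simp]: "act M (s # ws) v = refl_s M s (act M ws v)"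
  and act_append: "act M (us @ ws) v = act M us (act M ws v)"
  by (simp_all add: act_def)

lemma word_act_eq_act: "word_act M w v = act M (map fst w) v"
  by (induction w) (auto simp: word_act_def)

lemma alpha_same [simp]: "alpha s s = 1"
  and alpha_other: "t \<noteq> s \<Longrightarrow> alpha s t = 0"
  by (simp_all add: alpha_def)

lemma alpha_inj [simp]: "alpha s = alpha t \<longleftrightarrow> s = t"
  by (metis alpha_other alpha_same zero_neq_one)

lemma supp_alpha: "{x. alpha s x \<noteq> 0} = {s}"
  by (auto simp: alpha_def)

lemma alpha_in_vecs: "s \<in> S \<Longrightarrow> alpha s \<in> vecs S"
  by (simp add: vecs_def supp_alpha)

text \<open>Two-term combinations cover sums, differences, negatives and zero at once; expressions
  such as \<open>1 * v z + (-1) * p z\<close> below are written to match this shape.\<close>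

lemma lincomb_in_vecs:
  assumes "u \<in> vecs S" and "v \<in> vecs S"
  shows "(\<lambda>x. a * u x + b * v x) \<in> vecs S"
proof -
  have "{x. a * u x + b * v x \<noteq> 0} \<subseteq> {x. u x \<noteq> 0} \<union> {x. v x \<noteq> 0}" by auto
  then show ?thesis using assms by (auto simp: vecs_def intro: finite_subset)
qed

lemma bil_superset:
  assumes "finite F" and "{x. u x \<noteq> 0} \<subseteq> F" and "{x. v x \<noteq> 0} \<subseteq> F"
  shows "bil M u v = (\<Sum>s\<in>F. \<Sum>t\<in>F. u s * v t * bil_coeff M s t)"
proof -
  have "bil M u v = (\<Sum>s\<in>{x. u x \<noteq> 0}. \<Sum>t\<in>F. u s * v t * bil_coeff M s t)"
    unfolding bil_def using assms by (intro sum.cong sum.mono_neutral_left) auto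
  also have "\<dots> = (\<Sum>s\<in>F. \<Sum>t\<in>F. u s * v t * bil_coeff M s t)"
    using assms by (intro sum.mono_neutral_left) auto
  finally show ?thesis .
qed

lemma bil_lincomb:
  assumes "u \<in> vecs S" and "v \<in> vecs S" and "w \<in> vecs S"
  shows "bil M (\<lambda>x. a * u x + b * v x) w = a * bil M u w + b * bil M v w"
proof -
  let ?F = "{x. u x \<noteq> 0} \<union> {x. v x \<noteq> 0} \<union> {x. w x \<noteq> 0}"
  have F: "finite ?F" using assms by (auto simp: vecs_def)
  have "bil M (\<lambda>x. a * u x + b * v x) w = (\<Sum>s\<in>?F. \<Sum>t\<in>?F. (a * u s + b * v s) * w t * bil_coeff M s t)"
    by (rule bil_superset[OF F]) auto
  also have "\<dots> = a * (\<Sum>s\<in>?F. \<Sum>t\<in>?F. u s * w t * bil_coeff M s t) + b * (\<Sum>s\<in>?F. \<Sum>t\<in>?F. v s * w t * bil_coeff M s t)"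
    by (simp add: sum_distrib_left sum.distrib algebra_simps)
  also have "\<dots> = a * bil M u w + b * bil M v w"
    by (subst (1 2) bil_superset[OF F]) auto
  finally show ?thesis .
qed

lemma bil_alpha: "bil M (alpha s) (alpha t) = bil_coeff M s t"
  by (simp add: bil_def supp_alpha)

lemma refl_s_in_vecs:
  assumes "v \<in> vecs S" and "s \<in> S"
  shows "refl_s M s v \<in> vecs S"
  using lincomb_in_vecs[OF assms(1) alpha_in_vecs[OF assms(2)], of 1 "- bil M v (alpha s)"]
  by (simp add: refl_s_def)

lemma act_in_vecs:
  assumes "ws \<in> lists S" and "v \<in> vecs S"
  shows "act M ws v \<in> vecs S"
  using assms(1) by (induction ws) (auto simp: assms(2) refl_s_in_vecs)

lemma refl_s_lincomb:
  assumes "u \<in> vecs S" and "v \<in> vecs S" and "s \<in> S"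
  shows "refl_s M s (\<lambda>x. a * u x + b * v x) = (\<lambda>x. a * refl_s M s u x + b * refl_s M s v x)"
  by (simp add: refl_s_def fun_eq_iff bil_lincomb[OF assms(1,2) alpha_in_vecs[OF assms(3)]] algebra_simps)

lemma act_lincomb:
  assumes "u \<in> vecs S" and "v \<in> vecs S" and "ws \<in> lists S"
  shows "act M ws (\<lambda>x. a * u x + b * v x) = (\<lambda>x. a * act M ws u x + b * act M ws v x)"
  using assms(3) by (induction ws) (simp_all add: refl_s_lincomb[where S = S] assms(1,2) act_in_vecs)

lemma refl_s_alpha: "refl_s M t (alpha s) = (\<lambda>x. alpha s x - bil_coeff M s t * alpha t x)"
  by (simp add: refl_s_def bil_alpha)

text \<open>Chebyshev polynomials of the second kind, normalised so that
  \<open>cheb (2 cos \<theta>) n * sin \<theta> = sin (n \<theta>)\<close>.\<close>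
fun cheb :: "real \<Rightarrow> nat \<Rightarrow> real" where
  "cheb c 0 = 0"
| "cheb c (Suc 0) = 1"
| "cheb c (Suc (Suc n)) = c * cheb c (Suc n) - cheb c n"

lemma cheb_cos: "cheb (2 * cos \<theta>) n * sin \<theta> = sin (real n * \<theta>)"
proof (induction "2 * cos \<theta>" n rule: cheb.induct)
  case (3 n)
  have "sin (real (Suc (Suc n)) * \<theta>) + sin (real n * \<theta>) = 2 * cos \<theta> * sin (real (Suc n) * \<theta>)"
    using sin_add[of "real (Suc n) * \<theta>" \<theta>] sin_diff[of "real (Suc n) * \<theta>" \<theta>]
    by (simp add: algebra_simps)
  then show ?case using 3 by (simp add: algebra_simps)
qed simp_all

text \<open>The degenerate angle \<theta> = 0, which corresponds to an infinite entry of the Coxeter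
  matrix.\<close>

lemma cheb_two: "cheb 2 n = real n"
  by (induction "2 :: real" n rule: cheb.induct) auto

section \<open>The invariant form and the dihedral computations in the geometric
  representation\<close>

locale coxeter =
  fixes S :: "'s set" and M :: "'s \<Rightarrow> 's \<Rightarrow> enat"
  assumes coxeter_matrix: "coxeter_matrix S M"
begin

lemma bil_coeff_same: "s \<in> S \<Longrightarrow> bil_coeff M s s = 2"
  using coxeter_matrix by (simp add: coxeter_matrix_def bil_coeff_def one_enat_def)

lemma bil_coeff_sym: "s \<in> S \<Longrightarrow> t \<in> S \<Longrightarrow> bil_coeff M s t = bil_coeff M t s"
  using coxeter_matrix by (cases "s = t") (auto simp: coxeter_matrix_def bil_coeff_def)

lemma M_sym: "s \<in> S \<Longrightarrow> t \<in> S \<Longrightarrow> M s t = M t s"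
  using coxeter_matrix by (cases "s = t") (auto simp: coxeter_matrix_def)

lemma M_ge_2:
  assumes "s \<in> S" and "t \<in> S" and "s \<noteq> t" and "M s t = enat m"
  shows "m \<ge> 2"
proof -
  have "2 \<le> enat m" using coxeter_matrix assms by (fastforce simp: coxeter_matrix_def)
  then show ?thesis by (simp add: numeral_eq_enat)
qed

lemma bil_sym:
  assumes "u \<in> vecs S" and "v \<in> vecs S"
  shows "bil M u v = bil M v u"
proof -
  let ?F = "{x. u x \<noteq> 0} \<union> {x. v x \<noteq> 0}"
  have F: "finite ?F" "?F \<subseteq> S" using assms by (auto simp: vecs_def)
  have "bil M u v = (\<Sum>s\<in>?F. \<Sum>t\<in>?F. u s * v t * bil_coeff M s t)"
    by (rule bil_superset[OF F(1)]) auto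
  also have "\<dots> = (\<Sum>t\<in>?F. \<Sum>s\<in>?F. u s * v t * bil_coeff M s t)"
    by (rule sum.swap)
  also have "\<dots> = (\<Sum>t\<in>?F. \<Sum>s\<in>?F. v t * u s * bil_coeff M t s)"
  proof (rule sum.cong[OF HOL.refl], rule sum.cong[OF HOL.refl])
    fix s t assume "t \<in> ?F" "s \<in> ?F"
    then have "bil_coeff M s t = bil_coeff M t s" using F(2) by (intro bil_coeff_sym) blast+
    then show "u s * v t * bil_coeff M s t = v t * u s * bil_coeff M t s" by simp
  qed
  also have "\<dots> = bil M v u"
    by (rule bil_superset[OF F(1), symmetric]) auto
  finally show ?thesis .
qed

lemma bil_refl_s:
  assumes "u \<in> vecs S" and "v \<in> vecs S" and "s \<in> S"
  shows "bil M (refl_s M s u) (refl_s M s v) = bil M u v"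
proof -
  note a = alpha_in_vecs[OF assms(3)]
  have left: "bil M (refl_s M s u) w = bil M u w - bil M u (alpha s) * bil M (alpha s) w"
    if "u \<in> vecs S" "w \<in> vecs S" for u w
    using bil_lincomb[OF that(1) a that(2), of M 1 "- bil M u (alpha s)"] by (simp add: refl_s_def)
  have "bil M w (refl_s M s v) = bil M w v - bil M v (alpha s) * bil M w (alpha s)" if "w \<in> vecs S" for w
    using left[OF assms(2) that] bil_sym[OF that] refl_s_in_vecs assms(2,3) a by metis
  then show ?thesis
    using assms a refl_s_in_vecs[of _ S s M]
    by (simp add: left bil_alpha bil_coeff_same bil_sym[OF a] algebra_simps)
qed

lemma bil_act:
  assumes "u \<in> vecs S" and "v \<in> vecs S" and "ws \<in> lists S"
  shows "bil M (act M ws u) (act M ws v) = bil M u v"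
  using assms(3) by (induction ws) (auto simp: bil_refl_s act_in_vecs assms)

lemma refl_s_invol:
  assumes "v \<in> vecs S" and "s \<in> S"
  shows "refl_s M s (refl_s M s v) = v"
proof -
  note a = alpha_in_vecs[OF assms(2)]
  have "bil M (refl_s M s v) (alpha s) = - bil M v (alpha s)"
    using bil_lincomb[OF assms(1) a a, of M 1 "- bil M v (alpha s)"] assms(2)
    by (simp add: refl_s_def bil_alpha bil_coeff_same)
  then show ?thesis by (simp add: refl_s_def[of M s "refl_s M s v"]) (simp add: refl_s_def)
qed

lemma act_rev_act:
  assumes "v \<in> vecs S" and "ws \<in> lists S"
  shows "act M (rev ws) (act M ws v) = v"
  using assms(2) by (induction ws) (auto simp: act_append refl_s_invol act_in_vecs assms(1))

lemma act_act_rev: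
  assumes "v \<in> vecs S" and "ws \<in> lists S"
  shows "act M ws (act M (rev ws) v) = v"
  using act_rev_act[OF assms(1), of "rev ws"] assms(2) by (simp add: in_lists_conv_set)

text \<open>The new front letter reflects in the root with coefficient \<open>cheb c k\<close> and
  replaces it by \<open>c * cheb c (Suc k) - cheb c k\<close>, leaving the other one alone. This is
  the recursion of \<open>cheb\<close>, with the two roots exchanging roles at each step.\<close>

lemma act_PiR_alpha:
  assumes "s \<in> S" and "t \<in> S"
  defines "c \<equiv> - bil_coeff M s t"
  shows "act M (PiR s t k) (alpha s) =
    (\<lambda>x. cheb c (Suc k) * alpha (if even k then s else t) x + cheb c k * alpha (if even k then t else s) x)"
proof (induction k)
  case 0
  show ?case by (simp add: PiR_def)
next
  case (Suc k)
  have "- bil_coeff M t s = c" using assms bil_coeff_sym by simp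
  then show ?case
    using assms(1,2) unfolding PiR_Suc_front act_Cons Suc
    by (simp add: refl_s_lincomb[where S = S] alpha_in_vecs refl_s_alpha bil_coeff_same fun_eq_iff
        flip: c_def) (auto simp: c_def algebra_simps)
qed

text \<open>For \<theta> = pi / m the value at k is sin (k \<theta>) / sin \<theta>. Its first
  positive zero is at k = m, with the values 1 and -1 just before and just after.\<close>

lemma cheb_finite:
  assumes "s \<in> S" and "t \<in> S" and "s \<noteq> t" and "M s t = enat m"
  defines "c \<equiv> - bil_coeff M s t"
  shows "cheb c m = 0" and "cheb c (m - 1) = 1" and "cheb c (Suc m) = - 1"
    and "0 < k \<Longrightarrow> k < m \<Longrightarrow> cheb c k > 0"
proof -
  have m: "m \<ge> 2" using M_ge_2 assms by blast
  define \<theta> where "\<theta> = pi / real m"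
  have c: "c = 2 * cos \<theta>" by (simp add: c_def bil_coeff_def assms \<theta>_def)
  have "\<theta> > 0" "\<theta> < pi" using m pi_gt_zero by (auto simp: \<theta>_def field_simps)
  then have sin: "sin \<theta> > 0" by (rule sin_gt_zero)
  have m\<theta>: "real m * \<theta> = pi" using m by (simp add: \<theta>_def)
  have eq: "cheb c k * sin \<theta> = sin (real k * \<theta>)" for k
    unfolding c by (rule cheb_cos)
  show 0: "cheb c m = 0" using eq[of m] sin m\<theta> by simp
  have "real (m - 1) * \<theta> = pi - \<theta>" using m m\<theta> by (simp add: of_nat_diff algebra_simps)
  then show 1: "cheb c (m - 1) = 1" using eq[of "m - 1"] sin by simp
  show "cheb c (Suc m) = - 1"
    using cheb.simps(3)[of c "m - 1"] m 0 1 by (simp add: Suc_diff_Suc numeral_2_eq_2)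
  show "cheb c k > 0" if "0 < k" "k < m"
  proof -
    have "real k * \<theta> < real m * \<theta>" using that \<open>\<theta> > 0\<close> by simp
    then have "sin (real k * \<theta>) > 0" using that \<open>\<theta> > 0\<close> m\<theta> by (intro sin_gt_zero) auto
    then show ?thesis using eq[of k] sin by (metis zero_less_mult_pos2)
  qed
qed

lemma cheb_pos:
  assumes "s \<in> S" and "t \<in> S" and "s \<noteq> t" and "0 < k" and "enat k < M s t"
  shows "cheb (- bil_coeff M s t) k > 0"
proof (cases "M s t")
  case (enat m)
  then show ?thesis using cheb_finite(4) assms by auto
next
  case infinity
  then show ?thesis using assms by (simp add: bil_coeff_def cheb_two)
qed

text \<open>The shadow of (v3) on roots: at \<open>k = m - 1\<close> the two coefficients are 0 and
  1, so a single simple root survives, and parity decides which.\<close>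

lemma act_PiR_simple:
  assumes "s \<in> S" and "t \<in> S" and "s \<noteq> t" and "M s t = enat m"
  shows "act M (PiR s t (m - 1)) (alpha s) = alpha (if even m then s else t)"
  using act_PiR_alpha[OF assms(1,2), of "m - 1"] cheb_finite(1,2)[OF assms] M_ge_2[OF assms]
  by (auto simp: fun_eq_iff)

text \<open>Both sides give the negative of one simple root: on the left because the coefficients at
  \<open>m\<close> are -1 and 0, on the right because the last letter negates \<open>alpha s\<close>
  and a word of length \<open>m - 1\<close> remains.\<close>

lemma act_braid_alpha:
  assumes "s \<in> S" and "t \<in> S" and "s \<noteq> t" and m: "M s t = enat m"
  shows "act M (PiR s t m) (alpha s) = act M (PiR t s m) (alpha s)"
proof -
  have "m \<ge> 2" using M_ge_2 assms by blast
  then obtain n where n: "m = Suc n" by (cases m) auto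
  have "refl_s M s (alpha s) = (\<lambda>x. (-1) * alpha s x + 0 * alpha s x)"
    by (simp add: refl_s_alpha bil_coeff_same assms)
  then have "act M (PiR t s m) (alpha s) = act M (PiR s t n) (\<lambda>x. (-1) * alpha s x + 0 * alpha s x)"
    by (simp add: n PiR_Suc act_append)
  also have "\<dots> = (\<lambda>x. (-1) * act M (PiR s t n) (alpha s) x + 0 * act M (PiR s t n) (alpha s) x)"
    using assms by (intro act_lincomb alpha_in_vecs PiR_in_lists)
  also have "\<dots> = (\<lambda>x. - alpha (if even m then s else t) x)"
    using act_PiR_simple[OF assms] by (simp add: n)
  also have "\<dots> = act M (PiR s t m) (alpha s)"
    using act_PiR_alpha[OF assms(1,2), of m] cheb_finite(1,3)[OF assms] by simp
  finally show ?thesis by simp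
qed

text \<open>The form is nondegenerate on the plane of \<open>alpha s\<close> and \<open>alpha t\<close>, so a vector is the sum of
  an element of this plane and a vector fixed by both reflections.\<close>
lemma act_braid:
  assumes "s \<in> S" and "t \<in> S" and "s \<noteq> t" and m: "M s t = enat m" and v: "v \<in> vecs S"
  shows "act M (PiR s t m) v = act M (PiR t s m) v"
proof -
  have m2: "m \<ge> 2" using M_ge_2 assms by blast
  define c where "c = - bil_coeff M s t"
  have c: "c = 2 * cos (pi / real m)" by (simp add: c_def bil_coeff_def m)
  have "pi / real m > 0" "pi / real m < pi" using m2 by (auto simp: field_simps)
  then have "sin (pi / real m) > 0" by (rule sin_gt_zero)
  moreover have "4 - c\<^sup>2 = 4 * (sin (pi / real m))\<^sup>2"
    by (simp add: c sin_squared_eq power_mult_distrib)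
  ultimately have d: "4 - c\<^sup>2 \<noteq> 0" by simp
  define x y where "x = bil M v (alpha s)" and "y = bil M v (alpha t)"
  \<comment> \<open>Cramer's rule for 2a - cb = x and 2b - ca = y, of determinant 4 - c^2: then
    \<open>p\<close> pairs with both roots exactly as \<open>v\<close> does.\<close>
  define a b where "a = (2 * x + c * y) / (4 - c\<^sup>2)" and "b = (2 * y + c * x) / (4 - c\<^sup>2)"
  define p where "p = (\<lambda>z. a * alpha s z + b * alpha t z)"
  define q where "q = (\<lambda>z. 1 * v z + (-1) * p z)"
  have pv: "p \<in> vecs S" unfolding p_def using assms by (intro lincomb_in_vecs alpha_in_vecs)
  have qv: "q \<in> vecs S" unfolding q_def using v pv by (rule lincomb_in_vecs)
  have vpq: "v = (\<lambda>z. 1 * p z + 1 * q z)" by (simp add: q_def)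
  have act_v: "act M ws v = (\<lambda>z. 1 * act M ws p z + 1 * act M ws q z)" if "ws \<in> lists S" for ws
    by (subst vpq) (rule act_lincomb[OF pv qv that])
  have cc: "bil_coeff M s t = - c" "bil_coeff M t s = - c" using bil_coeff_sym assms by (simp_all add: c_def)
  note av = alpha_in_vecs[OF assms(1)] alpha_in_vecs[OF assms(2)]
  have "bil M p (alpha s) = 2 * a - c * b" "bil M p (alpha t) = 2 * b - c * a"
    unfolding p_def using av bil_coeff_same assms(1,2) by (simp_all add: bil_lincomb bil_alpha cc)
  moreover have "2 * a - c * b = x" "2 * b - c * a = y"
  proof -
    have "a * (4 - c\<^sup>2) = 2 * x + c * y" "b * (4 - c\<^sup>2) = 2 * y + c * x"
      using d by (simp_all add: a_def b_def)
    moreover have "(2 * a - c * b) * (4 - c\<^sup>2) = 2 * (a * (4 - c\<^sup>2)) - c * (b * (4 - c\<^sup>2))"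
      "(2 * b - c * a) * (4 - c\<^sup>2) = 2 * (b * (4 - c\<^sup>2)) - c * (a * (4 - c\<^sup>2))"
      by (simp_all only: left_diff_distrib mult.assoc)
    ultimately have "(2 * a - c * b) * (4 - c\<^sup>2) = x * (4 - c\<^sup>2)" "(2 * b - c * a) * (4 - c\<^sup>2) = y * (4 - c\<^sup>2)"
      by (simp_all add: algebra_simps power2_eq_square)
    then show "2 * a - c * b = x" "2 * b - c * a = y" using d by simp_all
  qed
  ultimately have q0: "bil M q (alpha s) = 0" "bil M q (alpha t) = 0"
    using bil_lincomb[OF v pv av(1), of M 1 "-1"] bil_lincomb[OF v pv av(2), of M 1 "-1"]
    by (simp_all add: x_def y_def q_def)
  have fix_q: "act M ws q = q" if "ws \<in> lists {s, t}" for ws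
    using that by (induction ws) (auto simp: refl_s_def q0)
  have P: "act M ws p = (\<lambda>z. a * act M ws (alpha s) z + b * act M ws (alpha t) z)" if "ws \<in> lists S" for ws
    unfolding p_def using av that by (rule act_lincomb)
  have "act M (PiR s t m) p = act M (PiR t s m) p"
    using assms act_braid_alpha[of s t m] act_braid_alpha[of t s m] M_sym[of s t] by (simp add: P)
  then show ?thesis
    using assms by (simp add: act_v fix_q)
qed

lemma word_act_pres_rel:
  assumes "(u, w) \<in> pres_rel (coxeter_rels S M)" and "u \<in> lists (S \<times> UNIV)" and "w \<in> lists (S \<times> UNIV)"
    and "v \<in> vecs S"
  shows "word_act M u v = word_act M w v"
proof -
  \<comment> \<open>A derivation may use letters outside \<open>S\<close>, where
    \<open>refl_s\<close> need not be an involution; they are deleted before acting.\<close>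
  define filt :: "('s \<times> bool) list \<Rightarrow> 's list" where "filt w = filter (\<lambda>s. s \<in> S) (map fst w)" for w
  have filt_in: "filt w \<in> lists S" for w by (auto simp: filt_def in_lists_conv_set)
  have filt_id: "filt w = map fst w" if "w \<in> lists (S \<times> UNIV)" for w
    using that by (auto simp: filt_def in_lists_conv_set filter_id_conv)
  have "act M (filt u) v = act M (filt w) v"
    using assms(1,4)
  proof (induction arbitrary: v)
    case (cancel g b)
    then show ?case by (simp add: filt_def refl_s_invol)
  next
    case (rel u w)
    then have "u \<in> lists (S \<times> UNIV)" "w \<in> lists (S \<times> UNIV)" using coxeter_rels_lists by blast+
    then show ?case using rel
      by (auto simp: filt_id coxeter_rels_def artin_rels_def refl_s_invol act_braid[symmetric])
  next
    case (ctx u w a c)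
    have "filt (a @ u @ c) = filt a @ filt u @ filt c" "filt (a @ w @ c) = filt a @ filt w @ filt c"
      by (simp_all add: filt_def)
    then show ?case using ctx filt_in by (simp add: act_append act_in_vecs)
  qed auto
  then show ?thesis using assms(2,3) by (simp add: word_act_eq_act filt_id)
qed

lemma wact_class:
  assumes w: "w \<in> lists (S \<times> UNIV)" and "v \<in> vecs S"
  shows "wact S M (pres_class (coxeter_rels S M) w) v = word_act M w v"
proof -
  define w' where "w' = (SOME u. u \<in> lists (S \<times> UNIV) \<and> u \<in> pres_class (coxeter_rels S M) w)"
  have w': "w' \<in> lists (S \<times> UNIV) \<and> w' \<in> pres_class (coxeter_rels S M) w"
    unfolding w'_def by (rule someI[of _ w]) (simp add: w self_in_pres_class)
  then have "word_act M w v = word_act M w' v"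
    using assms by (intro word_act_pres_rel) (auto simp: pres_class_def)
  then show ?thesis by (simp add: wact_def w'_def)
qed

lemma square_rel: "s \<in> S \<Longrightarrow> (pos [s, s], []) \<in> pres_rel (coxeter_rels S M)"
  by (rule pres_rel.rel) (auto simp: coxeter_rels_def)

end

section \<open>Elements of the Coxeter group as unsigned words, and the root system\<close>

lemma pres_rel_letter_sign:
  assumes "(pos [g, g], []) \<in> pres_rel R"
  shows "([(g, b)], [(g, True)]) \<in> pres_rel R"
proof (cases b)
  case False
  have "([(g, False)] @ [], [(g, False)] @ pos [g, g]) \<in> pres_rel R"
    using assms by (intro pres_rel_append pres_rel.refl) (rule pres_rel.sym)
  moreover have "([(g, False), (g, True)] @ [(g, True)], [] @ [(g, True)]) \<in> pres_rel R"
    using pres_rel.cancel[of g False R] by (intro pres_rel_append pres_rel.refl) simp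
  ultimately show ?thesis using False by (auto intro: pres_rel.trans)
qed (simp add: pres_rel.refl)

lemma pres_rel_positive:
  assumes "\<And>g. g \<in> Xg \<Longrightarrow> (pos [g, g], []) \<in> pres_rel R" and "w \<in> lists (Xg \<times> UNIV)"
  shows "(w, pos (map fst w)) \<in> pres_rel R"
  using assms(2)
proof (induction w)
  case (Cons x w)
  obtain g b where x: "x = (g, b)" by force
  have "([(g, b)] @ w, [(g, True)] @ pos (map fst w)) \<in> pres_rel R"
    using Cons assms(1) x by (intro pres_rel_append pres_rel_letter_sign) auto
  then show ?case by (simp add: x)
qed (simp add: pres_rel.refl)

context coxeter
begin

lemma coxeter_carrier: "carrier (coxeter_group S M) = (\<lambda>ws. pres_class (coxeter_rels S M) (pos ws)) ` lists S"
proof (rule subset_antisym; rule subsetI)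
  fix x assume "x \<in> carrier (coxeter_group S M)"
  then obtain w where w: "w \<in> lists (S \<times> UNIV)" "x = pres_class (coxeter_rels S M) w"
    by (auto simp: coxeter_group_def pres_carrier)
  then have "(w, pos (map fst w)) \<in> pres_rel (coxeter_rels S M)"
    using square_rel by (intro pres_rel_positive) 
  then have "x = pres_class (coxeter_rels S M) (pos (map fst w))" using w by (simp add: pres_class_eq_iff)
  moreover have "map fst w \<in> lists S" using w by (auto simp: in_lists_conv_set)
  ultimately show "x \<in> (\<lambda>ws. pres_class (coxeter_rels S M) (pos ws)) ` lists S" by blast
qed (auto simp: coxeter_group_def intro: pres_class_in_carrier)

lemma wact_pos:
  "ws \<in> lists S \<Longrightarrow> v \<in> vecs S \<Longrightarrow> wact S M (pres_class (coxeter_rels S M) (pos ws)) v = act M ws v"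
  by (simp add: wact_class word_act_eq_act)

lemma root_system_eq: "root_system S M = {act M ws (alpha s) | ws s. ws \<in> lists S \<and> s \<in> S}"
  unfolding root_system_def coxeter_carrier
  by (auto simp: wact_pos alpha_in_vecs) (metis wact_pos alpha_in_vecs imageI)+

lemma root_system_subset_vecs: "root_system S M \<subseteq> vecs S"
  by (auto simp: root_system_eq intro!: act_in_vecs alpha_in_vecs)

lemma alpha_in_root_system: "s \<in> S \<Longrightarrow> alpha s \<in> root_system S M"
  unfolding root_system_eq by (rule CollectI, rule exI[of _ "[]"]) auto

lemma refl_s_root_system:
  assumes "\<beta> \<in> root_system S M" and "s \<in> S"
  shows "refl_s M s \<beta> \<in> root_system S M"
proof -
  obtain ws t where "\<beta> = act M ws (alpha t)" "ws \<in> lists S" "t \<in> S"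
    using assms(1) by (auto simp: root_system_eq)
  then show ?thesis
    unfolding root_system_eq using assms(2) by (intro CollectI exI[of _ "s # ws"] exI[of _ t]) auto
qed

end

section \<open>Length and positivity of roots\<close>

text \<open>A reduced word contains no square, so in a dihedral subgroup this leaves only
  alternating words.\<close>

lemma list_alternating:
  assumes "us \<in> lists {a, b}"
  shows "us = alt a b (length us) \<or> us = alt b a (length us) \<or> (\<exists>x y c. c \<in> {a, b} \<and> us = x @ [c, c] @ y)"
  using assms
proof (induction us)
  case (Cons d us)
  from Cons.IH consider (square) x y c where "c \<in> {a, b}" "us = x @ [c, c] @ y"
    | (alt) "us = alt a b (length us) \<or> us = alt b a (length us)"
    by blast
  then show ?case
  proof cases
    case square
    then have "d # us = (d # x) @ [c, c] @ y" by simp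
    then show ?thesis using square(1) by blast
  next
    case alt
    show ?thesis
    proof (cases us)
      case Nil
      then show ?thesis using Cons.hyps by auto
    next
      case (Cons e us')
      show ?thesis
      proof (cases "d = e")
        case True
        then have "d # us = [] @ [d, d] @ us'" using Cons by simp
        then show ?thesis using Cons.hyps by blast
      next
        case False
        then show ?thesis using alt Cons.hyps Cons by auto
      qed
    qed
  qed
qed simp

lemma list_alternating_PiR:
  assumes "us \<in> lists {a, b}"
  shows "us = PiR a b (length us) \<or> us = PiR b a (length us) \<or> (\<exists>x y c. c \<in> {a, b} \<and> us = x @ [c, c] @ y)"
proof -
  have "rev us \<in> lists {a, b}" using assms by (simp add: in_lists_conv_set)
  from list_alternating[OF this] consider "rev us = alt a b (length us)" | "rev us = alt b a (length us)"
    | x y c where "c \<in> {a, b}" "rev us = x @ [c, c] @ y"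
    by auto
  then show ?thesis
  proof cases
    case 3
    then have "us = rev y @ [c, c] @ rev x" by (simp add: rev_swap)
    then show ?thesis using 3(1) by blast
  qed (simp_all add: PiR_def rev_swap)
qed

text \<open>Exposes the suffix of length \<open>m\<close> to which the braid relation
  applies.\<close>

lemma PiR_add: "\<exists>zs. length zs = n \<and> set zs \<subseteq> {a, b} \<and> PiR a b (m + n) = zs @ PiR a b m"
proof (induction n)
  case (Suc n)
  then obtain zs where "length zs = n" "set zs \<subseteq> {a, b}" "PiR a b (m + n) = zs @ PiR a b m" by blast
  then show ?case
    by (intro exI[of _ "(if even (m + n) then b else a) # zs"]) (simp add: PiR_Suc_front del: even_add)
qed simp

context coxeter
begin

definition ceq :: "'s list \<Rightarrow> 's list \<Rightarrow> bool" (infix "\<bowtie>" 50) where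
  "us \<bowtie> ws \<longleftrightarrow> (pos us, pos ws) \<in> pres_rel (coxeter_rels S M)"

lemma ceq_refl [simp]: "ws \<bowtie> ws"
  by (simp add: ceq_def pres_rel.refl)

lemma ceq_sym: "us \<bowtie> ws \<Longrightarrow> ws \<bowtie> us"
  by (simp add: ceq_def pres_rel.sym)

lemma ceq_trans [trans]: "us \<bowtie> ws \<Longrightarrow> ws \<bowtie> zs \<Longrightarrow> us \<bowtie> zs"
  unfolding ceq_def by (rule pres_rel.trans)

lemma ceq_append: "us \<bowtie> us' \<Longrightarrow> ws \<bowtie> ws' \<Longrightarrow> us @ ws \<bowtie> us' @ ws'"
  by (simp add: ceq_def pres_rel_append)

lemma ceq_square: "s \<in> S \<Longrightarrow> us @ [s, s] @ ws \<bowtie> us @ ws"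
  using ceq_append[OF ceq_refl ceq_append[OF _ ceq_refl], of "[s, s]" "[]" us ws] square_rel
  by (simp add: ceq_def)

lemma ceq_braid:
  assumes "s \<in> S" and "t \<in> S" and "s \<noteq> t" and "M s t = enat m"
  shows "PiR s t m \<bowtie> PiR t s m"
proof -
  have "(pos (PiR t s (the_enat (M s t))), pos (PiR s t (the_enat (M s t)))) \<in> coxeter_rels S M"
    using assms unfolding coxeter_rels_def artin_rels_def by blast
  then show ?thesis using assms by (auto simp: ceq_def intro: pres_rel.rel pres_rel.sym)
qed

lemma act_ceq:
  assumes "us \<bowtie> ws" and "us \<in> lists S" and "ws \<in> lists S" and "v \<in> vecs S"
  shows "act M us v = act M ws v"
  using word_act_pres_rel[of "pos us" "pos ws" v] assms by (simp add: ceq_def word_act_eq_act)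

definition len :: "'s list \<Rightarrow> nat" where
  "len ws = (LEAST n. \<exists>us\<in>lists S. length us = n \<and> ws \<bowtie> us)"

lemma len_le: "ws \<bowtie> us \<Longrightarrow> us \<in> lists S \<Longrightarrow> len ws \<le> length us"
  unfolding len_def by (rule Least_le) blast

lemma len_witness:
  assumes "ws \<in> lists S"
  obtains us where "us \<in> lists S" and "length us = len ws" and "ws \<bowtie> us"
proof -
  have "\<exists>us\<in>lists S. length us = len ws \<and> ws \<bowtie> us"
    unfolding len_def by (rule LeastI[of _ "length ws"]) (use assms in auto)
  then show ?thesis using that by blast
qed

lemma len_cong: "us \<bowtie> ws \<Longrightarrow> len us = len ws"
  unfolding len_def by (metis ceq_sym ceq_trans)

text \<open>Take \<open>t\<close> to be the last letter of a reduced expression of \<open>ws\<close> and split off a maximal suffix in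
  the letters \<open>s\<close> and \<open>t\<close>.\<close>
lemma parabolic_decomposition:
  assumes ws: "ws \<in> lists S" and s: "s \<in> S" and up: "len (ws @ [s]) \<ge> len ws" and "len ws > 0"
  obtains t v k where "t \<in> S" and "s \<noteq> t" and "v \<in> lists S" and "k > 0" and "enat k < M s t"
    and "ws \<bowtie> v @ PiR s t k" and "len v < len ws"
    and "len (v @ [s]) \<ge> len v" and "len (v @ [t]) \<ge> len v"
proof -
  obtain xs where xs: "xs \<in> lists S" "length xs = len ws" "ws \<bowtie> xs"
    using ws by (rule len_witness)
  then obtain us t where us: "xs = us @ [t]" using assms(4) by (cases xs rule: rev_cases) auto
  have t: "t \<in> S" and usS: "us \<in> lists S" using xs us by auto
  \<comment> \<open>Such an expression, multiplied by \<open>s\<close>, would collapse to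
    \<open>zs\<close> and make \<open>ws @ [s]\<close> shorter than \<open>ws\<close>, against
    \<open>up\<close>. All constraints on the suffix that involve \<open>s\<close> come from
    here.\<close>
  have no_end_s: False if "ws \<bowtie> zs @ [s]" "zs \<in> lists S" "length zs < len ws" for zs
  proof -
    have "ws @ [s] \<bowtie> (zs @ [s]) @ [s]" using that(1) by (intro ceq_append) auto
    also have "(zs @ [s]) @ [s] \<bowtie> zs" using ceq_square[OF s, of zs "[]"] by simp
    finally show False using len_le[of "ws @ [s]" zs] that up by simp
  qed
  have st: "s \<noteq> t" using no_end_s[of us] xs us usS by auto
  \<comment> \<open>\<open>n\<close> is the length of the prefix in a reduced expression whose
    remaining letters are \<open>s\<close> and \<open>t\<close>. Minimizing \<open>n\<close> makes
    that suffix maximal.\<close>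
  define Q where "Q n \<longleftrightarrow> (\<exists>v u. v \<in> lists S \<and> u \<in> lists {s, t} \<and> ws \<bowtie> v @ u \<and>
    length v + length u = len ws \<and> length v = n)" for n
  have Q0: "Q (length us)"
    unfolding Q_def using xs us usS by (intro exI[of _ us] exI[of _ "[t]"]) auto
  then have "Q (LEAST n. Q n)" by (rule LeastI)
  then obtain v u where v: "v \<in> lists S" and u: "u \<in> lists {s, t}" and wsvu: "ws \<bowtie> v @ u"
    and lvu: "length v + length u = len ws" and lv: "length v = (LEAST n. Q n)"
    unfolding Q_def by blast
  have lv_less: "length v < len ws" using Least_le[of Q, OF Q0] xs us lv by simp
  have uS: "u \<in> lists S" using u s t by (auto simp: in_lists_conv_set)
  have short: "len ws \<le> length zs" if "ws \<bowtie> zs" "zs \<in> lists S" for zs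
    using that by (rule len_le)
  have len_v: "len v = length v"
  proof (rule antisym)
    show "len v \<le> length v" using len_le v by simp
    obtain v' where v': "v' \<in> lists S" "length v' = len v" "v \<bowtie> v'" using v by (rule len_witness)
    have "ws \<bowtie> v' @ u" using wsvu ceq_append[OF v'(3) ceq_refl] by (rule ceq_trans)
    then show "length v \<le> len v" using short[of "v' @ u"] v' uS lvu by simp
  qed
  \<comment> \<open>If \<open>c\<close> shortened \<open>v\<close>, then \<open>v\<close> could be
    rewritten as a shorter \<open>v'\<close> followed by \<open>c\<close>; moving \<open>c\<close>
    into the suffix would contradict the minimality of the prefix.\<close>
  have up_v: "len (v @ [c]) \<ge> len v" if c: "c \<in> {s, t}" for c
  proof (rule ccontr)
    assume "\<not> len (v @ [c]) \<ge> len v"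
    then have less: "len (v @ [c]) < length v" by (simp add: len_v)
    have cS: "c \<in> S" using c s t by auto
    obtain v' where v': "v' \<in> lists S" "length v' = len (v @ [c])" "v @ [c] \<bowtie> v'"
      using v cS by (auto intro: len_witness[of "v @ [c]"])
    have "v @ u \<bowtie> (v @ [c]) @ c # u" using ceq_square[OF cS, of v u] by (auto intro: ceq_sym)
    also have "(v @ [c]) @ c # u \<bowtie> v' @ c # u" using v'(3) by (rule ceq_append) simp
    finally have ws': "ws \<bowtie> v' @ c # u" using wsvu ceq_trans by blast
    have "len ws \<le> length (v' @ c # u)" using ws' v' cS uS by (intro short) auto
    then have "length v' + length (c # u) = len ws" using lvu v' less by simp
    then have "Q (length v')" unfolding Q_def using v' ws' u c by (intro exI[of _ v'] exI[of _ "c # u"]) auto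
    then show False using Least_le[of Q "length v'"] lv v' less by simp
  qed
  have "\<not> (\<exists>x y c. c \<in> {s, t} \<and> u = x @ [c, c] @ y)"
  proof
    assume "\<exists>x y c. c \<in> {s, t} \<and> u = x @ [c, c] @ y"
    then obtain x y c where c: "c \<in> {s, t}" "u = x @ [c, c] @ y" by blast
    then have "v @ u \<bowtie> v @ x @ y" using ceq_square[of c "v @ x" y] s t by auto
    then have "ws \<bowtie> v @ x @ y" using wsvu ceq_trans by blast
    then show False using short[of "v @ x @ y"] v uS c lvu by auto
  qed
  moreover have "u \<noteq> PiR t s (length u)"
  proof
    assume u': "u = PiR t s (length u)"
    obtain n where n: "length u = Suc n" using lvu lv_less by (cases "length u") auto
    have "ws \<bowtie> (v @ PiR s t n) @ [s]" using wsvu u' by (simp add: n PiR_Suc)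
    then show False using v s t lvu n by (intro no_end_s[of "v @ PiR s t n"]) auto
  qed
  ultimately have u_eq: "u = PiR s t (length u)" using list_alternating_PiR[OF u] by blast
  \<comment> \<open>Otherwise the last \<open>m\<close> letters of the alternating suffix could be
    flipped by the braid relation, giving a reduced expression that ends in
    \<open>s\<close>.\<close>
  have "enat (length u) < M s t"
  proof (rule ccontr)
    assume "\<not> enat (length u) < M s t"
    then obtain m where m: "M s t = enat m" and "m \<le> length u" by (cases "M s t") auto
    then obtain n where n: "length u = m + n" using le_Suc_ex by blast
    obtain zs where zs: "length zs = n" "set zs \<subseteq> {s, t}" "PiR s t (m + n) = zs @ PiR s t m"
      using PiR_add[of n s t m] by blast
    have "m > 0" using M_ge_2[OF s t st m] by simp
    then obtain m' where m': "m = Suc m'" using gr0_implies_Suc by blast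
    have "v @ zs @ PiR s t m \<bowtie> v @ zs @ PiR t s m"
      using ceq_braid[OF s t st m] by (intro ceq_append) auto
    moreover have "u = zs @ PiR s t m" using u_eq n zs(3) by simp
    ultimately have "ws \<bowtie> v @ zs @ PiR t s m" using wsvu ceq_trans by blast
    then have "ws \<bowtie> (v @ zs @ PiR s t m') @ [s]" by (simp add: m' PiR_Suc)
    moreover have "zs \<in> lists S" using zs(2) s t by (auto simp: in_lists_conv_set)
    ultimately show False
      using v s t zs(1) lvu n m' by (intro no_end_s[of "v @ zs @ PiR s t m'"]) auto
  qed
  moreover have "length u > 0" using lvu lv_less by linarith
  moreover have "ws \<bowtie> v @ PiR s t (length u)" using wsvu u_eq by metis
  ultimately show ?thesis
    using that[of t v "length u"] t st v lv_less len_v up_v by simp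
qed

lemma len_0: "ws \<in> lists S \<Longrightarrow> len ws = 0 \<Longrightarrow> ws \<bowtie> []"
  by (metis len_witness length_0_conv)

text \<open>Reduces the image of \<open>alpha s\<close> under \<open>ws\<close> to images of simple
  roots under the shorter \<open>v\<close>; this drives both inductions on length below.\<close>

lemma act_parabolic:
  assumes "s \<in> S" and "t \<in> S" and "v \<in> lists S" and "ws \<in> lists S" and "ws \<bowtie> v @ PiR s t k"
  shows "act M ws (alpha s) = (\<lambda>x. cheb (- bil_coeff M s t) (Suc k) * act M v (alpha (if even k then s else t)) x
      + cheb (- bil_coeff M s t) k * act M v (alpha (if even k then t else s)) x)"
proof -
  have "act M ws (alpha s) = act M (v @ PiR s t k) (alpha s)"
    using assms by (intro act_ceq alpha_in_vecs) auto
  also have "\<dots> = act M v (\<lambda>x. cheb (- bil_coeff M s t) (Suc k) * alpha (if even k then s else t) x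
      + cheb (- bil_coeff M s t) k * alpha (if even k then t else s) x)"
    by (simp only: act_append act_PiR_alpha[OF assms(1,2)])
  also have "\<dots> = (\<lambda>x. cheb (- bil_coeff M s t) (Suc k) * act M v (alpha (if even k then s else t)) x
      + cheb (- bil_coeff M s t) k * act M v (alpha (if even k then t else s)) x)"
    using assms by (intro act_lincomb alpha_in_vecs) auto
  finally show ?thesis .
qed

lemma cheb_nonneg:
  assumes "s \<in> S" and "t \<in> S" and "s \<noteq> t" and "enat k < M s t"
  shows "cheb (- bil_coeff M s t) (Suc k) \<ge> 0"
proof (cases "enat (Suc k) < M s t")
  case True
  then show ?thesis using cheb_pos[OF assms(1-3), of "Suc k"] by simp
next
  case False
  then have "M s t = enat (Suc k)" using assms(4) by (cases "M s t") auto
  then show ?thesis using cheb_finite(1)[OF assms(1-3)] by simp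
qed

text \<open>Positivity of roots. The prefix \<open>v\<close> of the decomposition is shortened by
  neither letter, so induction makes the images of both simple roots nonnegative, and the Chebyshev
  coefficients are nonnegative because \<open>k\<close> stays below \<open>M s t\<close>.\<close>

lemma act_alpha_nonneg:
  assumes "ws \<in> lists S" and "s \<in> S" and "len (ws @ [s]) \<ge> len ws"
  shows "act M ws (alpha s) x \<ge> 0"
  using assms
proof (induction "len ws" arbitrary: ws s rule: less_induct)
  case less
  show ?case
  proof (cases "len ws = 0")
    case True
    then have "act M ws (alpha s) = act M [] (alpha s)"
      using less.prems by (intro act_ceq len_0 alpha_in_vecs) auto
    then show ?thesis by (simp add: alpha_def)
  next
    case False
    then obtain t v k where D: "t \<in> S" "s \<noteq> t" "v \<in> lists S" "k > 0" "enat k < M s t"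
      "ws \<bowtie> v @ PiR s t k" "len v < len ws" "len (v @ [s]) \<ge> len v" "len (v @ [t]) \<ge> len v"
      using parabolic_decomposition[OF less.prems] by blast
    have "act M v (alpha c) x \<ge> 0" if "c \<in> {s, t}" for c
      using less.hyps[of v c] D less.prems that by blast
    moreover have "cheb (- bil_coeff M s t) k \<ge> 0" "cheb (- bil_coeff M s t) (Suc k) \<ge> 0"
      using cheb_pos[OF less.prems(2) D(1,2,4,5)] cheb_nonneg[OF less.prems(2) D(1,2,5)] by simp_all
    ultimately show ?thesis
      unfolding act_parabolic[OF less.prems(2) D(1,3) less.prems(1) D(6)] by (intro add_nonneg_nonneg mult_nonneg_nonneg) auto
  qed
qed

text \<open>If \<open>s\<close> shortened \<open>ws\<close>, positivity would apply to
  \<open>ws @ [s]\<close>, which sends \<open>alpha s\<close> to the negative of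
  \<open>alpha p\<close>; its coordinate at \<open>p\<close> is -1.\<close>

lemma len_le_of_simple_image:
  assumes "ws \<in> lists S" and "s \<in> S" and "act M ws (alpha s) = alpha p"
  shows "len (ws @ [s]) \<ge> len ws"
proof (rule ccontr)
  assume "\<not> len (ws @ [s]) \<ge> len ws"
  moreover have "len ((ws @ [s]) @ [s]) = len ws"
    using ceq_square[OF assms(2), of ws "[]"] by (intro len_cong) simp
  ultimately have "act M (ws @ [s]) (alpha s) p \<ge> 0"
    using assms by (intro act_alpha_nonneg) auto
  moreover have "refl_s M s (alpha s) = (\<lambda>x. (-1) * alpha s x + 0 * alpha s x)"
    by (simp add: refl_s_alpha bil_coeff_same assms)
  then have "act M (ws @ [s]) (alpha s) = (\<lambda>x. (-1) * act M ws (alpha s) x + 0 * act M ws (alpha s) x)"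
    using assms(1,2) by (simp only: act_append act_Cons act_Nil) (intro act_lincomb alpha_in_vecs)
  ultimately show False using assms(3) by simp
qed

text \<open>\<open>v\<close> acts injectively, so two independent roots cannot both land on the line
  through \<open>alpha p\<close>.\<close>

lemma act_alpha_not_proportional:
  assumes "v \<in> lists S" and "s \<in> S" and "t \<in> S" and "s \<noteq> t"
    and "\<And>x. x \<noteq> p \<Longrightarrow> act M v (alpha s) x = 0" and "\<And>x. x \<noteq> p \<Longrightarrow> act M v (alpha t) x = 0"
  shows False
proof -
  have inj: "u = w" if "act M v u = act M v w" "u \<in> vecs S" "w \<in> vecs S" for u w
    using act_rev_act[of u v] act_rev_act[of w v] that assms(1) by metis
  \<comment> \<open>The combination of the two images that cancels at \<open>p\<close>; every other
    coordinate vanishes by assumption.\<close>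
  define a b where "a = act M v (alpha t) p" and "b = - act M v (alpha s) p"
  have "act M v (\<lambda>x. a * alpha s x + b * alpha t x) = (\<lambda>x. a * act M v (alpha s) x + b * act M v (alpha t) x)"
    using assms by (intro act_lincomb alpha_in_vecs)
  also have "\<dots> = (\<lambda>x. 0 * act M v (alpha s) x + 0 * act M v (alpha t) x)"
  proof
    fix x
    show "a * act M v (alpha s) x + b * act M v (alpha t) x = 0 * act M v (alpha s) x + 0 * act M v (alpha t) x"
      by (cases "x = p") (simp_all add: a_def b_def assms(5,6))
  qed
  also have "\<dots> = act M v (\<lambda>x. 0 * alpha s x + 0 * alpha t x)"
    using assms by (intro act_lincomb[symmetric] alpha_in_vecs)
  finally have eq: "(\<lambda>x. a * alpha s x + b * alpha t x) = (\<lambda>x. 0 * alpha s x + 0 * alpha t x)"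
    by (rule inj) (intro lincomb_in_vecs alpha_in_vecs assms(2,3))+
  have "a = 0" "b = 0" using fun_cong[OF eq, of s] fun_cong[OF eq, of t] assms(4) by (auto simp: alpha_other)
  \<comment> \<open>Now both images vanish at \<open>p\<close> as well, so they are both
    zero.\<close>
  have "act M v (alpha s) = act M v (alpha t)"
  proof
    fix x
    show "act M v (alpha s) x = act M v (alpha t) x"
      using \<open>a = 0\<close> \<open>b = 0\<close> by (cases "x = p") (simp_all add: a_def b_def assms(5,6))
  qed
  then have "alpha s = alpha t" using assms(2,3) by (rule inj[OF _ alpha_in_vecs alpha_in_vecs])
  then show False using assms(4) by simp
qed

text \<open>An element sending a simple root to a simple root is a product of elements for which this
  is the dihedral identity behind relation (v3).\<close>
lemma simple_image_induct [consumes 3, case_names Nil step]: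
  assumes "ws \<in> lists S" and "s \<in> S" and "act M ws (alpha s) = alpha p"
    and Nil: "\<And>ws s. ws \<in> lists S \<Longrightarrow> s \<in> S \<Longrightarrow> ws \<bowtie> [] \<Longrightarrow> P ws s s"
    and step: "\<And>ws v s t p m. ws \<in> lists S \<Longrightarrow> v \<in> lists S \<Longrightarrow> s \<in> S \<Longrightarrow> t \<in> S \<Longrightarrow> s \<noteq> t \<Longrightarrow>
      M s t = enat m \<Longrightarrow> ws \<bowtie> v @ PiR s t (m - 1) \<Longrightarrow> P v (if even m then s else t) p \<Longrightarrow> P ws s p"
  shows "P ws s p"
  using assms(1-3)
proof (induction "len ws" arbitrary: ws s rule: less_induct)
  case less
  show ?case
  proof (cases "len ws = 0")
    case True
    then have 0: "ws \<bowtie> []" using less.prems by (intro len_0)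
    then have "act M ws (alpha s) = act M [] (alpha s)"
      using less.prems by (intro act_ceq alpha_in_vecs) auto
    then show ?thesis using less.prems Nil[OF _ _ 0] by simp
  next
    case False
    then obtain t v k where D: "t \<in> S" "s \<noteq> t" "v \<in> lists S" "k > 0" "enat k < M s t"
      "ws \<bowtie> v @ PiR s t k" "len v < len ws" "len (v @ [s]) \<ge> len v" "len (v @ [t]) \<ge> len v"
      using parabolic_decomposition[OF less.prems(1,2) len_le_of_simple_image[OF less.prems]] by blast
    define c where "c = - bil_coeff M s t"
    define y z where "y = (if even k then s else t)" and "z = (if even k then t else s)"
    have yz: "y \<in> S" "z \<in> S" "y \<noteq> z" using D less.prems by (auto simp: y_def z_def)
    have nonneg: "act M v (alpha y) x \<ge> 0" "act M v (alpha z) x \<ge> 0" for x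
      using D less.prems by (auto simp: y_def z_def intro!: act_alpha_nonneg)
    have eq: "alpha p x = cheb c (Suc k) * act M v (alpha y) x + cheb c k * act M v (alpha z) x" for x
      using act_parabolic[OF less.prems(2) D(1,3) less.prems(1) D(6)] less.prems(3)
      unfolding c_def y_def z_def by metis
    have ck: "cheb c k > 0" unfolding c_def using cheb_pos less.prems D by blast
    \<comment> \<open>Extremality of \<open>alpha p\<close>: outside \<open>p\<close>, a combination
      of nonnegative values with positive coefficients is zero, so both images would be supported at
      \<open>p\<close>.\<close>
    have "\<not> enat (Suc k) < M s t"
    proof
      assume "enat (Suc k) < M s t"
      then have ck': "cheb c (Suc k) > 0" unfolding c_def using cheb_pos less.prems D by blast
      have "act M v (alpha y) x = 0 \<and> act M v (alpha z) x = 0" if "x \<noteq> p" for x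
      proof -
        have "cheb c (Suc k) * act M v (alpha y) x + cheb c k * act M v (alpha z) x = 0"
          using eq[of x] that by (simp add: alpha_other)
        then show ?thesis using ck ck' nonneg[of x]
          by (metis add_nonneg_eq_0_iff less_imp_le less_irrefl mult_eq_0_iff mult_nonneg_nonneg)
      qed
      then show False using act_alpha_not_proportional[OF D(3) yz, of p] by blast
    qed
    then have m: "M s t = enat (Suc k)" using D(5) by (cases "M s t") auto
    have "cheb c (Suc k) = 0" "cheb c k = 1"
      using cheb_finite(1,2)[OF less.prems(2) D(1,2) m] by (simp_all add: c_def)
    then have "act M v (alpha z) = alpha p" using eq by (simp add: fun_eq_iff)
    then have "P v z p" using less.hyps D yz by blast
    then show ?thesis
      using step[OF less.prems(1) D(3) less.prems(2) D(1,2) m, of p] D(6) by (auto simp: z_def split: if_splits)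
  qed
qed

end

section \<open>The kernel as an Artin group\<close>

context coxeter
begin

abbreviation "VR \<equiv> va_rels S M"
abbreviation "CR \<equiv> coxeter_rels S M"
abbreviation "VA \<equiv> va_group S M"
abbreviation "\<Phi> \<equiv> root_system S M"
abbreviation "HR \<equiv> artin_rels (root_system S M) (hat_M S M)"

section \<open>Words in sigma and tau, and the well-definedness of the conjugates of sigma\<close>

lemma tau_rel_word:
  assumes "(u, v) \<in> pres_rel CR"
  shows "(map (apfst Inr) u, map (apfst Inr) v) \<in> pres_rel VR"
  using assms
proof (rule pres_rel_map)
  fix u v assume "(u, v) \<in> CR"
  then consider "(u, v) \<in> artin_rels S M" | s where "s \<in> S" "u = pos [s, s]" "v = []"
    by (auto simp: coxeter_rels_def)
  then show "(map (apfst Inr) u, map (apfst Inr) v) \<in> pres_rel VR"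
  proof cases
    case 1
    then show ?thesis by (intro pres_rel.rel) (force simp: va_rels_def)
  next
    case 2
    then show ?thesis by (intro pres_rel.rel) (auto simp: va_rels_def)
  qed
qed

text \<open>Unsigned words suffice for the conjugation arguments: the defining relations are
  positive, and a tau word is inverted by reversing it.\<close>

definition veq :: "('s + 's) list \<Rightarrow> ('s + 's) list \<Rightarrow> bool" (infix "\<asymp>" 50) where
  "u \<asymp> v \<longleftrightarrow> (pos u, pos v) \<in> pres_rel VR"

lemma veq_refl [simp]: "u \<asymp> u"
  by (simp add: veq_def pres_rel.refl)

lemma veq_sym: "u \<asymp> v \<Longrightarrow> v \<asymp> u"
  by (simp add: veq_def pres_rel.sym)

lemma veq_trans [trans]: "u \<asymp> v \<Longrightarrow> v \<asymp> w \<Longrightarrow> u \<asymp> w"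
  unfolding veq_def by (rule pres_rel.trans)

lemma veq_append: "u \<asymp> u' \<Longrightarrow> v \<asymp> v' \<Longrightarrow> u @ v \<asymp> u' @ v'"
  by (simp add: veq_def pres_rel_append)

lemma veq_context: "u \<asymp> v \<Longrightarrow> a @ u @ c \<asymp> a @ v @ c"
  by (intro veq_append) simp_all

lemma tau_veq: "us \<bowtie> ws \<Longrightarrow> map Inr us \<asymp> map Inr ws"
  using tau_rel_word[of "pos us" "pos ws"] by (simp add: ceq_def veq_def map_apfst_pos)

lemma sigma_braid:
  assumes "s \<in> S" and "t \<in> S" and "s \<noteq> t" and "M s t = enat m"
  shows "map Inl (PiR t s m) \<asymp> map Inl (PiR s t m)"
proof -
  have "map_prod (map (apfst Inl)) (map (apfst Inl)) (pos (PiR t s m), pos (PiR s t m)) \<in> VR"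
    using artin_relI[of s S t M m] assms unfolding va_rels_def by (intro UnI1 imageI)
  then show ?thesis by (auto simp: veq_def map_apfst_pos intro: pres_rel.rel)
qed

lemma mixed_relation:
  assumes "s \<in> S" and "t \<in> S" and "s \<noteq> t" and "M s t = enat m"
  shows "map Inr (PiR s t (m - 1)) @ [Inl s] \<asymp> Inl (if even m then s else t) # map Inr (PiR s t (m - 1))"
proof -
  have "(pos (PiR (Inr s) (Inr t) (the_enat (M s t) - 1) @ [Inl s]),
        pos (Inl (if even (the_enat (M s t)) then s else t) # PiR (Inr s) (Inr t) (the_enat (M s t) - 1))) \<in> VR"
    using assms unfolding va_rels_def by blast
  then have "(pos (map Inr (PiR s t (m - 1)) @ [Inl s]),
      pos (Inl (if even m then s else t) # map Inr (PiR s t (m - 1)))) \<in> VR"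
    by (simp only: assms(4) the_enat.simps map_PiR)
  then show ?thesis unfolding veq_def by (rule pres_rel.rel)
qed

lemma tau_sigma_simple:
  assumes "ws \<in> lists S" and "s \<in> S" and "act M ws (alpha s) = alpha p"
  shows "map Inr ws @ [Inl s] \<asymp> Inl p # map Inr ws"
  using assms
proof (induction rule: simple_image_induct)
  case (Nil ws s)
  then have ws: "map Inr ws \<asymp> []" using tau_veq by fastforce
  have "map Inr ws @ [Inl s] \<asymp> [] @ [Inl s]" using ws by (intro veq_append) simp_all
  also have "[] @ [Inl s] \<asymp> [Inl s] @ []" by simp
  also have "[Inl s] @ [] \<asymp> [Inl s] @ map Inr ws" using ws by (rule veq_append[OF veq_refl veq_sym])
  finally show ?case by simp
next
  case (step ws v s t p m)
  let ?P = "map Inr (PiR s t (m - 1))" and ?q = "if even m then s else t"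
  have ws: "map Inr ws \<asymp> map Inr v @ ?P" using tau_veq[OF step(7)] by simp
  have "map Inr ws @ [Inl s] \<asymp> (map Inr v @ ?P) @ [Inl s]" using ws by (intro veq_append) simp_all
  also have "\<dots> = map Inr v @ (?P @ [Inl s])" by simp
  also have "\<dots> \<asymp> map Inr v @ (Inl ?q # ?P)"
    using step mixed_relation by (intro veq_append) simp_all
  also have "\<dots> = (map Inr v @ [Inl ?q]) @ ?P" by simp
  also have "\<dots> \<asymp> (Inl p # map Inr v) @ ?P" using step(8) by (intro veq_append) simp_all
  also have "\<dots> = [Inl p] @ (map Inr v @ ?P)" by simp
  also have "\<dots> \<asymp> [Inl p] @ map Inr ws" using ws by (rule veq_append[OF veq_refl veq_sym])
  finally show ?case by simp
qed

lemma ceq_rev: "ws \<in> lists S \<Longrightarrow> ws @ rev ws \<bowtie> []"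
proof (induction ws)
  case (Cons s ws)
  then have "[s] @ (ws @ rev ws) @ [s] \<bowtie> [s] @ [] @ [s]" by (intro ceq_append) auto
  also have "[s] @ [] @ [s] \<bowtie> []" using ceq_square[of s "[]" "[]"] Cons by simp
  finally show ?case by simp
qed simp

lemma rev_in_lists: "ws \<in> lists S \<Longrightarrow> rev ws \<in> lists S"
  by (simp add: in_lists_conv_set)

lemma tau_rev:
  assumes "ws \<in> lists S"
  shows "map Inr ws @ map Inr (rev ws) \<asymp> []" and "map Inr (rev ws) @ map Inr ws \<asymp> []"
proof -
  have "rev ws \<in> lists S" using assms by (simp add: in_lists_conv_set)
  then show "map Inr ws @ map Inr (rev ws) \<asymp> []" and "map Inr (rev ws) @ map Inr ws \<asymp> []"
    using tau_veq[OF ceq_rev[OF assms]] tau_veq[OF ceq_rev[of "rev ws"]] by simp_all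
qed

definition conj_word :: "'s list \<Rightarrow> ('s + 's) list \<Rightarrow> ('s + 's) list" where
  "conj_word ws u = map Inr ws @ u @ map Inr (rev ws)"

text \<open>The element \<open>rev ws' @ ws\<close> sends \<open>alpha s\<close> to
  \<open>alpha s'\<close>, so by \<open>tau_sigma_simple\<close> its tau word can be moved past
  sigma_s, turning it into sigma_s'.\<close>

lemma conj_word_unique:
  assumes "ws \<in> lists S" and "s \<in> S" and "ws' \<in> lists S" and "s' \<in> S"
    and "act M ws (alpha s) = act M ws' (alpha s')"
  shows "conj_word ws [Inl s] \<asymp> conj_word ws' [Inl s']"
proof -
  let ?w = "map Inr ws :: ('s + 's) list" and ?w' = "map Inr ws' :: ('s + 's) list"
  let ?v = "map Inr (rev ws) :: ('s + 's) list" and ?v' = "map Inr (rev ws') :: ('s + 's) list"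
  have "act M (rev ws' @ ws) (alpha s) = alpha s'"
    using assms by (simp add: act_append act_rev_act alpha_in_vecs)
  then have "map Inr (rev ws' @ ws) @ [Inl s] \<asymp> Inl s' # map Inr (rev ws' @ ws)"
    using assms by (intro tau_sigma_simple) (auto simp: in_lists_conv_set)
  then have stab: "?v' @ ?w @ [Inl s] \<asymp> [Inl s'] @ ?v' @ ?w" by simp
  have "conj_word ws [Inl s] = [] @ [] @ (?w @ [Inl s] @ ?v)" by (simp add: conj_word_def)
  also have "\<dots> \<asymp> [] @ (?w' @ ?v') @ (?w @ [Inl s] @ ?v)"
    using tau_rev(1)[OF assms(3)] by (rule veq_context[OF veq_sym])
  also have "\<dots> = ?w' @ (?v' @ ?w @ [Inl s]) @ ?v" by simp
  also have "\<dots> \<asymp> ?w' @ ([Inl s'] @ ?v' @ ?w) @ ?v" using stab by (rule veq_context)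
  also have "\<dots> = (?w' @ [Inl s'] @ ?v') @ (?w @ ?v) @ []" by simp
  also have "\<dots> \<asymp> (?w' @ [Inl s'] @ ?v') @ [] @ []" using tau_rev[OF assms(1)] by (intro veq_context)
  also have "\<dots> = conj_word ws' [Inl s']" by (simp add: conj_word_def)
  finally show ?thesis .
qed

definition cls :: "('s + 's) list \<Rightarrow> ('s + 's) word set" where
  "cls u = pres_class VR (pos u)"

lemma cls_eq_iff: "cls u = cls v \<longleftrightarrow> u \<asymp> v"
  by (simp add: cls_def pres_class_eq_iff veq_def)

lemma group_VA: "group VA"
  unfolding va_group_def by (rule group_pres_group)

lemma cls_mult: "cls u \<otimes>\<^bsub>VA\<^esub> cls v = cls (u @ v)"
  by (simp add: cls_def va_group_def pres_mult)

lemma cls_one: "\<one>\<^bsub>VA\<^esub> = cls []"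
  by (simp add: cls_def va_group_def pres_one)

lemma cls_in_carrier: "u \<in> lists (va_gens S) \<Longrightarrow> cls u \<in> carrier VA"
  by (simp add: cls_def va_group_def pres_class_in_carrier)

lemma map_Inr_in_lists: "ws \<in> lists S \<Longrightarrow> map Inr ws \<in> lists (va_gens S)"
  by (auto simp: va_gens_def in_lists_conv_set)

lemma conj_word_in_lists:
  "ws \<in> lists S \<Longrightarrow> u \<in> lists (va_gens S) \<Longrightarrow> conj_word ws u \<in> lists (va_gens S)"
  by (auto simp: conj_word_def va_gens_def in_lists_conv_set)

lemma inv_cls_tau: "ws \<in> lists S \<Longrightarrow> inv\<^bsub>VA\<^esub> (cls (map Inr ws)) = cls (map Inr (rev ws))"
  by (rule group.inv_equality[OF group_VA])
    (simp_all only: cls_mult cls_one cls_eq_iff tau_rev cls_in_carrier map_Inr_in_lists rev_in_lists)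

lemma iota_class:
  assumes "w \<in> lists (S \<times> UNIV)"
  shows "iota_W S M (pres_class CR w) = pres_class VR (map (apfst Inr) w)"
proof -
  interpret VA: group VA by (rule group_VA)
  have ev: "eval_word VA (tau S M) w = pres_class VR (map (apfst Inr) w)" if "w \<in> lists (S \<times> UNIV)" for w
    using eval_word_pres_gen[OF that, of Inr "va_gens S" VR]
    by (simp add: va_gens_def va_group_def tau_def[abs_def])
  have "iota_W S M (pres_class CR w) = eval_word VA (tau S M) w"
    unfolding iota_W_def
  proof (rule VA.pres_lift_class)
    show "tau S M \<in> S \<rightarrow> carrier VA"
      by (auto simp: tau_def pres_gen_def va_group_def va_gens_def intro!: pres_class_in_carrier)
    show "CR \<subseteq> lists (S \<times> UNIV) \<times> lists (S \<times> UNIV)" by (rule coxeter_rels_lists)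
    show "eval_word VA (tau S M) u = eval_word VA (tau S M) v" if "(u, v) \<in> CR" for u v
    proof -
      have "u \<in> lists (S \<times> UNIV)" "v \<in> lists (S \<times> UNIV)" using that coxeter_rels_lists by blast+
      then show ?thesis using that by (simp add: ev pres_class_eq_iff tau_rel_word pres_rel.rel)
    qed
  qed (rule assms)
  then show ?thesis using ev[OF assms] by simp
qed

text \<open>\<open>delta\<close> is defined by choice; \<open>conj_word_unique\<close> makes all
  candidates equal, so any expression of the root may be used to compute it.\<close>

lemma delta_eq:
  assumes "ws \<in> lists S" and "s \<in> S"
  shows "delta S M (act M ws (alpha s)) = cls (conj_word ws [Inl s])"
proof -
  have conj: "iota_W S M (pres_class CR (pos us)) \<otimes>\<^bsub>VA\<^esub> sigma S M t \<otimes>\<^bsub>VA\<^esub> inv\<^bsub>VA\<^esub> (iota_W S M (pres_class CR (pos us)))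
      = cls (conj_word us [Inl t])" if "us \<in> lists S" for us t
  proof -
    have "sigma S M t = cls [Inl t]" by (simp add: cls_def sigma_def pres_gen_def)
    moreover have "iota_W S M (pres_class CR (pos us)) = cls (map Inr us)"
      using that by (simp add: cls_def iota_class map_apfst_pos)
    ultimately show ?thesis using that by (simp add: inv_cls_tau cls_mult conj_word_def)
  qed
  show ?thesis
    unfolding delta_def
  proof (rule some_equality)
    show "\<exists>w\<in>carrier (coxeter_group S M). \<exists>t\<in>S. wact S M w (alpha t) = act M ws (alpha s) \<and>
        cls (conj_word ws [Inl s]) = iota_W S M w \<otimes>\<^bsub>VA\<^esub> sigma S M t \<otimes>\<^bsub>VA\<^esub> inv\<^bsub>VA\<^esub> (iota_W S M w)"
      using assms by (intro bexI[of _ "pres_class CR (pos ws)"] bexI[of _ s])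
        (simp_all add: coxeter_carrier wact_pos alpha_in_vecs conj)
  next
    fix d
    assume "\<exists>w\<in>carrier (coxeter_group S M). \<exists>t\<in>S. wact S M w (alpha t) = act M ws (alpha s) \<and>
        d = iota_W S M w \<otimes>\<^bsub>VA\<^esub> sigma S M t \<otimes>\<^bsub>VA\<^esub> inv\<^bsub>VA\<^esub> (iota_W S M w)"
    then obtain us t where us: "us \<in> lists S" "t \<in> S"
      and eq: "wact S M (pres_class CR (pos us)) (alpha t) = act M ws (alpha s)"
      and d: "d = cls (conj_word us [Inl t])"
      using conj by (auto simp: coxeter_carrier)
    have "act M us (alpha t) = act M ws (alpha s)" using eq us by (simp add: wact_pos alpha_in_vecs)
    then show "d = cls (conj_word ws [Inl s])"
      unfolding d cls_eq_iff using us assms by (intro conj_word_unique)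
  qed
qed

section \<open>The Coxeter matrix on the roots and its relators\<close>

definition simple_pair :: "('s \<Rightarrow> real) \<Rightarrow> ('s \<Rightarrow> real) \<Rightarrow> enat \<Rightarrow> bool" where
  "simple_pair \<beta> \<gamma> m \<longleftrightarrow> (\<exists>ws\<in>lists S. \<exists>s\<in>S. \<exists>t\<in>S.
     \<beta> = act M ws (alpha s) \<and> \<gamma> = act M ws (alpha t) \<and> M s t \<noteq> \<infinity> \<and> m = M s t)"

lemma hat_M_eq:
  "hat_M S M \<beta> \<gamma> = (if \<beta> = \<gamma> then 1 else if \<exists>m. simple_pair \<beta> \<gamma> m then SOME m. simple_pair \<beta> \<gamma> m else \<infinity>)"
proof -
  have "(\<exists>w\<in>carrier (coxeter_group S M). \<exists>s\<in>S. \<exists>t\<in>S.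
      \<beta> = wact S M w (alpha s) \<and> \<gamma> = wact S M w (alpha t) \<and> M s t \<noteq> \<infinity> \<and> m = M s t) \<longleftrightarrow> simple_pair \<beta> \<gamma> m" for m
    unfolding simple_pair_def coxeter_carrier bex_simps(7)
    by (intro bex_cong HOL.refl) (simp add: wact_pos alpha_in_vecs)
  note sp = this
  have "(\<exists>w\<in>carrier (coxeter_group S M). \<exists>s\<in>S. \<exists>t\<in>S.
      \<beta> = wact S M w (alpha s) \<and> \<gamma> = wact S M w (alpha t) \<and> M s t \<noteq> \<infinity>) \<longleftrightarrow> (\<exists>m. simple_pair \<beta> \<gamma> m)"
    unfolding sp[symmetric] by blast
  then show ?thesis unfolding hat_M_def sp by simp
qed

lemma hat_M_finite:
  assumes "\<beta> \<noteq> \<gamma>" and "hat_M S M \<beta> \<gamma> \<noteq> \<infinity>"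
  shows "simple_pair \<beta> \<gamma> (hat_M S M \<beta> \<gamma>)"
  using assms by (auto simp: hat_M_eq split: if_splits intro: someI)

lemma simple_pair_refl_s:
  assumes "simple_pair \<beta> \<gamma> m" and "r \<in> S"
  shows "simple_pair (refl_s M r \<beta>) (refl_s M r \<gamma>) m"
proof -
  obtain ws s t where "ws \<in> lists S" "s \<in> S" "t \<in> S" "\<beta> = act M ws (alpha s)" "\<gamma> = act M ws (alpha t)"
    "M s t \<noteq> \<infinity>" "m = M s t"
    using assms(1) unfolding simple_pair_def by blast
  then show ?thesis
    unfolding simple_pair_def using assms(2)
    by (intro bexI[of _ "r # ws"] bexI[of _ s] bexI[of _ t]) auto
qed

text \<open>A common expression of two roots is reflected by prepending \<open>r\<close>, and the
  reflection is its own inverse. So reflections are automorphisms of the Coxeter graph on the roots,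
  which lets tau_r act on the Artin group.\<close>

lemma hat_M_refl_s:
  assumes "\<beta> \<in> \<Phi>" and "\<gamma> \<in> \<Phi>" and "r \<in> S"
  shows "hat_M S M (refl_s M r \<beta>) (refl_s M r \<gamma>) = hat_M S M \<beta> \<gamma>"
proof -
  have inv: "refl_s M r (refl_s M r \<beta>) = \<beta>" "refl_s M r (refl_s M r \<gamma>) = \<gamma>"
    using assms root_system_subset_vecs by (auto intro!: refl_s_invol)
  then have "refl_s M r \<beta> = refl_s M r \<gamma> \<longleftrightarrow> \<beta> = \<gamma>" by metis
  moreover have "simple_pair (refl_s M r \<beta>) (refl_s M r \<gamma>) = simple_pair \<beta> \<gamma>"
    using simple_pair_refl_s[OF _ assms(3)] inv by (intro ext) metis
  ultimately show ?thesis by (simp only: hat_M_eq)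
qed

text \<open>The invariant form remembers the entry: it takes the value -2 cos (pi / m) on the pair,
  and cosine is injective on the interval from 0 to pi.\<close>

lemma simple_pair_unique:
  assumes "simple_pair \<beta> \<gamma> m" and "simple_pair \<beta> \<gamma> m'" and "\<beta> \<noteq> \<gamma>"
  shows "m = m'"
proof -
  have main: "\<exists>n\<ge>2. m = enat n \<and> bil M \<beta> \<gamma> = - 2 * cos (pi / real n)" if sp: "simple_pair \<beta> \<gamma> m" for m
  proof -
    obtain ws s t where st: "ws \<in> lists S" "s \<in> S" "t \<in> S" "\<beta> = act M ws (alpha s)" "\<gamma> = act M ws (alpha t)"
      "M s t \<noteq> \<infinity>" "m = M s t"
      using sp unfolding simple_pair_def by blast
    obtain n where n: "M s t = enat n" using st(6) by auto
    have "s \<noteq> t" using st(4,5) assms(3) by metis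
    then have "n \<ge> 2" using M_ge_2 st(2,3) n by blast
    moreover have "bil M \<beta> \<gamma> = bil_coeff M s t" using st by (simp add: bil_act alpha_in_vecs bil_alpha)
    ultimately show ?thesis using st(7) n by (intro exI[of _ n]) (simp add: bil_coeff_def)
  qed
  obtain n n' where n: "n \<ge> 2" "m = enat n" "n' \<ge> 2" "m' = enat n'"
    and "cos (pi / real n) = cos (pi / real n')"
    using main[OF assms(1)] main[OF assms(2)] by auto
  moreover have "0 \<le> pi / real k \<and> pi / real k \<le> pi" if "k \<ge> 2" for k :: nat
    using that by (auto simp: field_simps)
  ultimately have "pi / real n = pi / real n'" using cos_inj_pi by blast
  then have "n = n'" using n by (simp add: field_simps)
  then show ?thesis using n by simp
qed

text \<open>Needed so that the braid relation (v1) among the sigmas is matched by a relator among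
  the simple roots.\<close>

lemma hat_M_alpha:
  assumes "s \<in> S" and "t \<in> S" and "s \<noteq> t" and "M s t \<noteq> \<infinity>"
  shows "hat_M S M (alpha s) (alpha t) = M s t"
proof -
  have "simple_pair (alpha s) (alpha t) (M s t)"
    unfolding simple_pair_def using assms by (intro bexI[of _ "[]"] bexI[of _ s] bexI[of _ t]) auto
  moreover from this have "(SOME m. simple_pair (alpha s) (alpha t) m) = M s t"
    using assms by (intro some_equality) (auto intro: simple_pair_unique)
  ultimately show ?thesis using assms by (auto simp: hat_M_eq)
qed

lemma delta_in_carrier: "delta S M \<in> \<Phi> \<rightarrow> carrier VA"
  by (auto simp: root_system_eq delta_eq
      intro!: cls_in_carrier conj_word_in_lists) (simp add: va_gens_def)

text \<open>The tau words between consecutive conjugates cancel, so one conjugation serves the whole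
  product. This presents each relator on the roots as a conjugate of (v1).\<close>

lemma eval_delta_conj:
  assumes "ws \<in> lists S" and "us \<in> lists S"
  shows "eval_word VA (delta S M) (pos (map (\<lambda>s. act M ws (alpha s)) us)) = cls (conj_word ws (map Inl us))"
  using assms(2)
proof (induction us)
  case Nil
  show ?case using veq_sym[OF tau_rev(1)[OF assms(1)]] by (simp add: cls_one conj_word_def cls_eq_iff)
next
  case (Cons s us)
  let ?w = "map Inr ws :: ('s + 's) list" and ?v = "map Inr (rev ws) :: ('s + 's) list"
  have "(?w @ [Inl s]) @ (?v @ ?w) @ (map Inl us @ ?v) \<asymp> (?w @ [Inl s]) @ [] @ (map Inl us @ ?v)"
    using tau_rev[OF assms(1)] by (intro veq_context)
  then have "conj_word ws [Inl s] @ conj_word ws (map Inl us) \<asymp> conj_word ws (map Inl (s # us))"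
    by (simp add: conj_word_def)
  moreover have "eval_word VA (delta S M) (pos (map (\<lambda>s. act M ws (alpha s)) (s # us)))
      = cls (conj_word ws [Inl s]) \<otimes>\<^bsub>VA\<^esub> cls (conj_word ws (map Inl us))"
    using Cons by (simp add: delta_eq[OF assms(1)])
  ultimately show ?case unfolding cls_mult by (simp add: cls_eq_iff)
qed

lemma eval_delta_artin_rels:
  assumes "(u, v) \<in> HR"
  shows "eval_word VA (delta S M) u = eval_word VA (delta S M) v"
proof -
  obtain \<beta> \<gamma> where uv: "u = pos (PiR \<gamma> \<beta> (the_enat (hat_M S M \<beta> \<gamma>)))" "v = pos (PiR \<beta> \<gamma> (the_enat (hat_M S M \<beta> \<gamma>)))"
    and "\<beta> \<noteq> \<gamma>" "hat_M S M \<beta> \<gamma> \<noteq> \<infinity>"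
    using assms by (auto simp: artin_rels_def)
  then obtain ws s t where st: "ws \<in> lists S" "s \<in> S" "t \<in> S" "\<beta> = act M ws (alpha s)" "\<gamma> = act M ws (alpha t)"
    and "M s t \<noteq> \<infinity>" "hat_M S M \<beta> \<gamma> = M s t"
    using hat_M_finite unfolding simple_pair_def by metis
  then obtain m where m: "M s t = enat m" "the_enat (hat_M S M \<beta> \<gamma>) = m" by auto
  have "s \<noteq> t" using st \<open>\<beta> \<noteq> \<gamma>\<close> by auto
  have "conj_word ws (map Inl (PiR t s m)) \<asymp> conj_word ws (map Inl (PiR s t m))"
    unfolding conj_word_def using sigma_braid st \<open>s \<noteq> t\<close> m by (intro veq_context)
  moreover have "u = pos (map (\<lambda>s. act M ws (alpha s)) (PiR t s m))" "v = pos (map (\<lambda>s. act M ws (alpha s)) (PiR s t m))"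
    using uv m st by (simp_all add: map_PiR)
  ultimately show ?thesis
    using st by (simp add: eval_delta_conj cls_eq_iff)
qed

section \<open>The action on words over the roots that detects injectivity\<close>

text \<open>Letters outside \<open>S\<close> act trivially, since derivations between words over \<open>S\<close> may use them.\<close>
definition vact :: "('s + 's) word \<Rightarrow> ('s \<Rightarrow> real) word \<Rightarrow> ('s \<Rightarrow> real) word" where
  "vact u x = foldr (\<lambda>(g, b) x. case g of
     Inl s \<Rightarrow> if s \<in> S then (alpha s, b) # x else x
   | Inr s \<Rightarrow> if s \<in> S then map (apfst (refl_s M s)) x else x) u x"

lemma vact_Nil [simp]: "vact [] x = x"
  and vact_Inl: "vact ((Inl s, b) # u) x = (if s \<in> S then (alpha s, b) # vact u x else vact u x)"
  and vact_Inr: "vact ((Inr s, b) # u) x = (if s \<in> S then map (apfst (refl_s M s)) (vact u x) else vact u x)"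
  and vact_append: "vact (u @ v) x = vact u (vact v x)"
  by (simp_all add: vact_def)

lemma vact_induct [case_names Nil Inl Inr]:
  assumes "P []" and "\<And>s b u. P u \<Longrightarrow> P ((Inl s, b) # u)" and "\<And>s b u. P u \<Longrightarrow> P ((Inr s, b) # u)"
  shows "P (u :: ('s + 's) word)"
proof (induction u)
  case (Cons x u)
  then show ?case using assms by (cases x; cases "fst x") auto
qed (rule assms)

lemma vact_in_lists: "x \<in> lists (\<Phi> \<times> UNIV) \<Longrightarrow> vact u x \<in> lists (\<Phi> \<times> UNIV)"
proof (induction u rule: vact_induct)
  case (Inr s b u)
  then show ?case
    by (auto simp: vact_Inr intro!: map_apfst_in_lists[of _ \<Phi>] refl_s_root_system)
qed (auto simp: vact_Inl alpha_in_root_system)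

lemma artin_rels_refl_s:
  assumes "(u, v) \<in> HR" and "r \<in> S"
  shows "(map (apfst (refl_s M r)) u, map (apfst (refl_s M r)) v) \<in> HR"
proof -
  obtain \<beta> \<gamma> where uv: "u = pos (PiR \<gamma> \<beta> (the_enat (hat_M S M \<beta> \<gamma>)))" "v = pos (PiR \<beta> \<gamma> (the_enat (hat_M S M \<beta> \<gamma>)))"
    and \<beta>\<gamma>: "\<beta> \<in> \<Phi>" "\<gamma> \<in> \<Phi>" "\<beta> \<noteq> \<gamma>" "hat_M S M \<beta> \<gamma> \<noteq> \<infinity>"
    using assms(1) by (auto simp: artin_rels_def)
  obtain m where m: "hat_M S M \<beta> \<gamma> = enat m" using \<beta>\<gamma>(4) by auto
  let ?\<beta> = "refl_s M r \<beta>" and ?\<gamma> = "refl_s M r \<gamma>"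
  have h: "hat_M S M ?\<beta> ?\<gamma> = hat_M S M \<beta> \<gamma>" using hat_M_refl_s \<beta>\<gamma> assms(2) by simp
  have "refl_s M r ?\<beta> = \<beta>" "refl_s M r ?\<gamma> = \<gamma>"
    using \<beta>\<gamma> assms root_system_subset_vecs by (auto intro!: refl_s_invol)
  then have "?\<beta> \<noteq> ?\<gamma>" using \<beta>\<gamma> by metis
  moreover have "?\<beta> \<in> \<Phi>" "?\<gamma> \<in> \<Phi>" using \<beta>\<gamma> assms(2) refl_s_root_system by auto
  ultimately have "(pos (PiR ?\<gamma> ?\<beta> m), pos (PiR ?\<beta> ?\<gamma> m)) \<in> HR"
    using h m by (intro artin_relI) simp_all
  then show ?thesis by (simp add: uv m map_apfst_pos map_PiR)
qed

text \<open>Prepending a letter respects every congruence, and reflecting all letters respects this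
  one because reflections permute the relators.\<close>

lemma vact_right_rel:
  assumes "(x, y) \<in> pres_rel HR"
  shows "(vact u x, vact u y) \<in> pres_rel HR"
proof (induction u rule: vact_induct)
  case Nil
  then show ?case using assms by simp
next
  case (Inl s b u)
  then show ?case using pres_rel.ctx[OF Inl, of "[(alpha s, b)]" "[]"] by (simp add: vact_Inl)
next
  case (Inr s b u)
  have "(map (apfst (refl_s M s)) (vact u x), map (apfst (refl_s M s)) (vact u y)) \<in> pres_rel HR" if "s \<in> S"
    using Inr artin_rels_refl_s[OF _ that] by (rule pres_rel_map[OF _ pres_rel.rel])
  then show ?case using Inr by (simp add: vact_Inr)
qed

lemma map_apfst_cong:
  assumes "x \<in> lists (\<Phi> \<times> UNIV)" and "\<And>v. v \<in> vecs S \<Longrightarrow> f v = g v"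
  shows "map (apfst f) x = map (apfst g) x"
  using assms root_system_subset_vecs by (force simp: in_lists_conv_set)

lemma vact_tau: "ws \<in> lists S \<Longrightarrow> vact (pos (map Inr ws)) x = map (apfst (act M ws)) x"
proof (induction ws)
  case (Cons s ws)
  then show ?case by (simp add: vact_Inr map_apfst_comp del: map_map)
qed (simp add: map_apfst_ident act_def[abs_def])

lemma vact_sigma: "ws \<in> lists S \<Longrightarrow> vact (pos (map Inl ws)) x = pos (map alpha ws) @ x"
  by (induction ws) (auto simp: vact_Inl)

text \<open>The right tau word carries \<open>x\<close> away and the left one brings it back; only
  the letter inserted in between, \<open>alpha s\<close>, is moved by \<open>ws\<close>
  alone.\<close>

lemma vact_conj:
  assumes "ws \<in> lists S" and "s \<in> S" and "x \<in> lists (\<Phi> \<times> UNIV)"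
  shows "vact (pos (conj_word ws [Inl s])) x = (act M ws (alpha s), True) # x"
proof -
  have "rev ws \<in> lists S" using assms(1) by (simp add: in_lists_conv_set)
  then have "vact (pos (conj_word ws [Inl s])) x
      = (act M ws (alpha s), True) # map (apfst (\<lambda>v. act M ws (act M (rev ws) v))) x"
    using assms vact_tau[of ws] vact_tau[of "rev ws"]
    by (simp add: conj_word_def vact_append vact_Inl map_apfst_comp del: map_map)
  also have "map (apfst (\<lambda>v. act M ws (act M (rev ws) v))) x = map (apfst (\<lambda>v. v)) x"
    using assms act_act_rev by (intro map_apfst_cong) auto
  finally show ?thesis by (simp add: map_apfst_ident)
qed

text \<open>Only (v1) and the cancellation of sigma letters need the relations among the roots. The
  tau relations hold as identities between maps on V, and (v3) reduces to
  \<open>act_PiR_simple\<close>, since a tau word followed by an inserted letter differs only in the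
  name of that letter; these cases give equal words.\<close>

lemma vact_left_rel:
  assumes "(u, v) \<in> pres_rel VR" and "x \<in> lists (\<Phi> \<times> UNIV)"
  shows "(vact u x, vact v x) \<in> pres_rel HR"
  using assms
proof (induction arbitrary: x)
  case (cancel g b)
  show ?case
  proof (cases g)
    case (Inl s)
    then show ?thesis
      using pres_rel_append[OF pres_rel.cancel[of "alpha s" b HR] pres_rel.refl[of x]]
      by (simp add: vact_Inl pres_rel.refl)
  next
    case (Inr s)
    have "map (apfst (\<lambda>v. refl_s M s (refl_s M s v))) x = map (apfst (\<lambda>v. v)) x" if "s \<in> S"
      using cancel that refl_s_invol by (intro map_apfst_cong) auto
    then show ?thesis
      using Inr by (simp add: vact_Inr map_apfst_comp map_apfst_ident pres_rel.refl del: map_map)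
  qed
next
  case (rel u v)
  from rel(1) consider
      (sigma) s t m where "s \<in> S" "t \<in> S" "s \<noteq> t" "M s t = enat m"
        "u = pos (map Inl (PiR t s m))" "v = pos (map Inl (PiR s t m))"
    | (tau) s t m where "s \<in> S" "t \<in> S" "s \<noteq> t" "M s t = enat m"
        "u = pos (map Inr (PiR t s m))" "v = pos (map Inr (PiR s t m))"
    | (square) s where "s \<in> S" "u = pos [Inr s, Inr s]" "v = []"
    | (mixed) s t m where "s \<in> S" "t \<in> S" "s \<noteq> t" "M s t = enat m"
        "u = pos (map Inr (PiR s t (m - 1)) @ [Inl s])"
        "v = pos (Inl (if even m then s else t) # map Inr (PiR s t (m - 1)))"
    unfolding va_rels_def artin_rels_def by (auto simp: map_apfst_pos map_PiR)
  then show ?case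
  proof cases
    case sigma
    then have "(pos (map alpha (PiR t s m)), pos (map alpha (PiR s t m))) \<in> HR"
      unfolding map_PiR using hat_M_alpha[of s t] alpha_in_root_system by (intro artin_relI) simp_all
    then show ?thesis
      using sigma by (simp add: vact_sigma pres_rel_append pres_rel.rel pres_rel.refl)
  next
    case tau
    then have "map (apfst (act M (PiR t s m))) x = map (apfst (act M (PiR s t m))) x"
      using act_braid[of s t m] rel(2) by (intro map_apfst_cong) auto
    then have "vact u x = vact v x" using tau by (simp only: vact_tau PiR_in_lists)
    then show ?thesis by (simp add: pres_rel.refl)
  next
    case square
    then have "map (apfst (\<lambda>v. refl_s M s (refl_s M s v))) x = map (apfst (\<lambda>v. v)) x"
      using rel(2) refl_s_invol by (intro map_apfst_cong) auto
    then show ?thesis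
      using square by (simp add: vact_Inr map_apfst_comp map_apfst_ident pres_rel.refl del: map_map)
  next
    case mixed
    then have "act M (PiR s t (m - 1)) (alpha s) = alpha (if even m then s else t)"
      by (intro act_PiR_simple)
    then have "vact u x = vact v x"
      using mixed by (simp add: vact_append vact_tau vact_Inl)
    then show ?thesis by (simp add: pres_rel.refl)
  qed
next
  case (ctx u v a c)
  then show ?case by (simp add: vact_append vact_in_lists vact_right_rel)
qed (auto intro: pres_rel.intros)

text \<open>Fed with \<open>(\<beta>, False) # x\<close>, the word \<open>u\<close> gives
  \<open>x\<close> up to the relations, and \<open>inv_word u\<close> undoes
  \<open>u\<close>.\<close>

lemma vact_inverse:
  assumes "\<And>x. x \<in> lists (\<Phi> \<times> UNIV) \<Longrightarrow> (vact u x, (\<beta>, True) # x) \<in> pres_rel HR"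
    and "\<beta> \<in> \<Phi>" and "x \<in> lists (\<Phi> \<times> UNIV)"
  shows "(vact (inv_word u) x, (\<beta>, False) # x) \<in> pres_rel HR"
proof -
  let ?y = "(\<beta>, False) # x"
  have y: "?y \<in> lists (\<Phi> \<times> UNIV)" using assms by simp
  have "((\<beta>, True) # ?y, x) \<in> pres_rel HR"
    using pres_rel_append[OF pres_rel.cancel[of \<beta> True HR] pres_rel.refl[of x]] by simp
  then have "(vact u ?y, x) \<in> pres_rel HR" using assms(1)[OF y] by (rule pres_rel.trans[rotated])
  then have "(vact (inv_word u) (vact u ?y), vact (inv_word u) x) \<in> pres_rel HR"
    by (rule vact_right_rel)
  moreover have "(vact (inv_word u @ u) ?y, vact [] ?y) \<in> pres_rel HR"
    using inv_word_append_cancel y by (rule vact_left_rel)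
  ultimately show ?thesis by (auto simp: vact_append intro: pres_rel.sym pres_rel.trans)
qed

text \<open>Produces a representative of the evaluated element whose action is known. The quantifier
  over all \<open>x\<close> is what allows the letters of \<open>w\<close> to be composed, although
  only the empty \<open>x\<close> is used afterwards.\<close>

lemma eval_delta_word:
  assumes "w \<in> lists (\<Phi> \<times> UNIV)"
  shows "\<exists>u. eval_word VA (delta S M) w = pres_class VR u \<and>
    (\<forall>x\<in>lists (\<Phi> \<times> UNIV). (vact u x, w @ x) \<in> pres_rel HR)"
  using assms
proof (induction w)
  case Nil
  show ?case by (intro exI[of _ "[]"]) (simp add: va_group_def pres_one pres_rel.refl)
next
  case (Cons y w)
  obtain \<beta> b where y: "y = (\<beta>, b)" by force
  have \<beta>: "\<beta> \<in> \<Phi>" using Cons y by simp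
  then obtain ws s where ws: "ws \<in> lists S" "s \<in> S" "\<beta> = act M ws (alpha s)"
    by (auto simp: root_system_eq)
  obtain u where u: "eval_word VA (delta S M) w = pres_class VR u"
    "\<And>x. x \<in> lists (\<Phi> \<times> UNIV) \<Longrightarrow> (vact u x, w @ x) \<in> pres_rel HR"
    using Cons by blast
  define d where "d = pos (conj_word ws [Inl s])"
  define d' where "d' = (if b then d else inv_word d)"
  have "d \<in> lists (va_gens S \<times> UNIV)"
    using conj_word_in_lists[OF ws(1), of "[Inl s]"] ws by (simp add: d_def va_gens_def)
  then have "eval_word VA (delta S M) ((\<beta>, b) # w) = pres_class VR (d' @ u)"
    using u(1) ws by (simp add: d'_def delta_eq cls_def va_group_def pres_inv pres_mult flip: d_def)
  moreover have "(vact d' x, (\<beta>, b) # x) \<in> pres_rel HR" if "x \<in> lists (\<Phi> \<times> UNIV)" for x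
  proof -
    have "(vact d x, (\<beta>, True) # x) \<in> pres_rel HR" if "x \<in> lists (\<Phi> \<times> UNIV)" for x
      using vact_conj[OF ws(1,2) that] ws by (simp add: d_def pres_rel.refl)
    then show ?thesis using vact_inverse[OF _ \<beta> that, of d] that by (cases b) (auto simp: d'_def)
  qed
  then have "(vact (d' @ u) x, ((\<beta>, b) # w) @ x) \<in> pres_rel HR" if "x \<in> lists (\<Phi> \<times> UNIV)" for x
  proof -
    have "w @ x \<in> lists (\<Phi> \<times> UNIV)" using Cons that by simp
    then have "(vact d' (w @ x), ((\<beta>, b) # w) @ x) \<in> pres_rel HR"
      using \<open>\<And>x. x \<in> lists (\<Phi> \<times> UNIV) \<Longrightarrow> (vact d' x, (\<beta>, b) # x) \<in> pres_rel HR\<close> by simp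
    moreover have "(vact d' (vact u x), vact d' (w @ x)) \<in> pres_rel HR"
      using u(2)[OF that] by (rule vact_right_rel)
    ultimately show ?thesis by (auto simp: vact_append intro: pres_rel.trans)
  qed
  ultimately show ?case unfolding y by blast
qed

text \<open>Acting on the empty word, which represents the identity, recovers \<open>w\<close> from
  its value up to the relations.\<close>

lemma eval_delta_inj:
  assumes "w \<in> lists (\<Phi> \<times> UNIV)" and "w' \<in> lists (\<Phi> \<times> UNIV)"
    and "eval_word VA (delta S M) w = eval_word VA (delta S M) w'"
  shows "(w, w') \<in> pres_rel HR"
proof -
  obtain u u' where "eval_word VA (delta S M) w = pres_class VR u" "(vact u [], w) \<in> pres_rel HR"
    and "eval_word VA (delta S M) w' = pres_class VR u'" "(vact u' [], w') \<in> pres_rel HR"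
    using eval_delta_word[OF assms(1)] eval_delta_word[OF assms(2)] by (metis append_Nil2 lists.Nil)
  moreover from this have "(vact u [], vact u' []) \<in> pres_rel HR"
    using assms(3) by (intro vact_left_rel) (simp_all flip: pres_class_eq_iff)
  ultimately show ?thesis by (meson pres_rel.sym pres_rel.trans)
qed

section \<open>The projection to the Coxeter group and its kernel\<close>

abbreviation "W \<equiv> coxeter_group S M"

definition pi_gen :: "'s + 's \<Rightarrow> 's word set" where
  "pi_gen g = (case g of Inl s \<Rightarrow> \<one>\<^bsub>W\<^esub> | Inr s \<Rightarrow> pres_gen CR s)"

lemma group_W: "group W"
  unfolding coxeter_group_def by (rule group_pres_group)

lemma pi_gen_in_carrier: "pi_gen \<in> va_gens S \<rightarrow> carrier W"
proof -
  interpret W: group W by (rule group_W)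
  have "pres_gen CR s \<in> carrier W" if "s \<in> S" for s
    using that by (simp add: pres_gen_def coxeter_group_def pres_class_in_carrier)
  then show ?thesis by (auto simp: va_gens_def pi_gen_def)
qed

lemma eval_pi_tau: "w \<in> lists (S \<times> UNIV) \<Longrightarrow> eval_word W pi_gen (map (apfst Inr) w) = pres_class CR w"
  using eval_word_pres_gen[of w S "\<lambda>x. x" S CR]
  by (simp add: eval_word_map pi_gen_def coxeter_group_def map_apfst_ident)

lemma eval_pi_sigma: "eval_word W pi_gen (map (apfst Inl) w) = \<one>\<^bsub>W\<^esub>"
proof -
  interpret W: group W by (rule group_W)
  show ?thesis
  proof (induction w)
    case (Cons x w)
    then show ?case by (cases x) (simp add: pi_gen_def)
  qed simp
qed

text \<open>The sigma letters become trivial, so (v1) collapses and both sides of (v3) leave the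
  same tau word; the tau relations are those of the Coxeter group.\<close>

lemma eval_pi_va_rels:
  assumes "(u, v) \<in> VR"
  shows "eval_word W pi_gen u = eval_word W pi_gen v"
proof -
  interpret W: group W by (rule group_W)
  have tau: "eval_word W pi_gen (pos (map Inr ws)) = pres_class CR (pos ws)" if "ws \<in> lists S" for ws
    using eval_pi_tau[of "pos ws"] that by (simp add: map_apfst_pos)
  from assms consider
      (sigma) x y where "u = map (apfst Inl) x" "v = map (apfst Inl) y"
    | (tau) x y where "(x, y) \<in> artin_rels S M" "u = map (apfst Inr) x" "v = map (apfst Inr) y"
    | (square) s where "s \<in> S" "u = pos (map Inr [s, s])" "v = pos (map Inr [])"
    | (mixed) s t m r where "s \<in> S" "t \<in> S" "r \<in> S" "u = pos (map Inr (PiR s t m) @ [Inl s])"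
        "v = pos (Inl r # map Inr (PiR s t m))"
    unfolding va_rels_def by (auto simp: map_PiR)
  then show ?thesis
  proof cases
    case sigma
    then show ?thesis by (simp only: eval_pi_sigma)
  next
    case tau
    then have "x \<in> lists (S \<times> UNIV)" "y \<in> lists (S \<times> UNIV)" using artin_rels_lists by blast+
    then show ?thesis using tau
      by (simp add: eval_pi_tau pres_class_eq_iff pres_rel.rel coxeter_rels_def)
  next
    case square
    then have "[s, s] \<in> lists S" "[] \<in> lists S" by auto
    then show ?thesis unfolding square using square(1) square_rel
      by (simp only: tau pres_class_eq_iff pos_Nil)
  next
    case mixed
    then have P: "PiR s t m \<in> lists S" by simp
    then have "pos (map Inr (PiR s t m)) \<in> lists (va_gens S \<times> UNIV)" using map_Inr_in_lists by simp
    moreover have "pos [Inl s] \<in> lists (va_gens S \<times> UNIV)" using mixed by (simp add: va_gens_def)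
    ultimately have "eval_word W pi_gen u = eval_word W pi_gen (pos (map Inr (PiR s t m))) \<otimes>\<^bsub>W\<^esub> eval_word W pi_gen (pos [Inl s])"
      unfolding mixed pos_append using pi_gen_in_carrier by (intro W.eval_word_append)
    moreover have "pres_class CR (pos (PiR s t m)) \<in> carrier W" using P by (simp add: coxeter_carrier)
    ultimately show ?thesis using P mixed by (simp add: tau pi_gen_def)
  qed
qed

lemma pi_K_eq: "pi_K S M = pres_lift (va_gens S) W pi_gen"
  by (simp add: pi_K_def pi_gen_def[abs_def])

lemma pi_K_class: "u \<in> lists (va_gens S \<times> UNIV) \<Longrightarrow> pi_K S M (pres_class VR u) = eval_word W pi_gen u"
  unfolding pi_K_eq
  by (rule group.pres_lift_class[OF group_W pi_gen_in_carrier va_rels_lists eval_pi_va_rels])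

lemma pi_K_hom: "group_hom VA W (pi_K S M)"
proof -
  have "pi_K S M \<in> hom VA W"
    unfolding pi_K_eq va_group_def
    by (rule group.pres_lift_hom[OF group_W pi_gen_in_carrier va_rels_lists eval_pi_va_rels])
  then show ?thesis using group_VA group_W by (simp add: group_hom_def group_hom_axioms_def)
qed

lemma pi_K_tau: "w \<in> lists (S \<times> UNIV) \<Longrightarrow> pi_K S M (pres_class VR (map (apfst Inr) w)) = pres_class CR w"
  by (subst pi_K_class) (auto simp: eval_pi_tau va_gens_def intro!: map_apfst_in_lists[of _ S])

lemma delta_in_KVA:
  assumes "\<beta> \<in> \<Phi>"
  shows "delta S M \<beta> \<in> KVA S M"
proof -
  interpret pi: group_hom VA W "pi_K S M" by (rule pi_K_hom)
  obtain ws s where ws: "ws \<in> lists S" "s \<in> S" "\<beta> = act M ws (alpha s)"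
    using assms by (auto simp: root_system_eq)
  let ?t = "cls (map Inr ws)" and ?s = "cls [Inl s]"
  have t: "?t \<in> carrier VA" using ws by (intro cls_in_carrier map_Inr_in_lists)
  have s: "?s \<in> carrier VA" using ws by (intro cls_in_carrier) (simp add: va_gens_def)
  have "pi_K S M ?s = \<one>\<^bsub>W\<^esub>"
    unfolding cls_def using ws by (subst pi_K_class) (auto simp: va_gens_def pi_gen_def)
  moreover have "delta S M \<beta> = ?t \<otimes>\<^bsub>VA\<^esub> ?s \<otimes>\<^bsub>VA\<^esub> inv\<^bsub>VA\<^esub> ?t"
    unfolding inv_cls_tau[OF ws(1)] cls_mult ws(3) delta_eq[OF ws(1,2)] by (simp add: conj_word_def)
  ultimately have "pi_K S M (delta S M \<beta>) = \<one>\<^bsub>W\<^esub>" "delta S M \<beta> \<in> carrier VA"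
    using t s by simp_all
  then show ?thesis by (simp add: KVA_def kernel_def)
qed

text \<open>By \<open>delta_eq\<close> the reflected root may be computed from any expression, here
  the one with \<open>s\<close> prepended.\<close>

lemma tau_conj_delta:
  assumes "\<beta> \<in> \<Phi>" and "s \<in> S"
  shows "cls [Inr s] \<otimes>\<^bsub>VA\<^esub> delta S M \<beta> \<otimes>\<^bsub>VA\<^esub> inv\<^bsub>VA\<^esub> (cls [Inr s]) = delta S M (refl_s M s \<beta>)"
proof -
  obtain ws t where ws: "ws \<in> lists S" "t \<in> S" "\<beta> = act M ws (alpha t)"
    using assms by (auto simp: root_system_eq)
  have "inv\<^bsub>VA\<^esub> (cls [Inr s]) = cls [Inr s]" using inv_cls_tau[of "[s]"] assms(2) by simp
  moreover have "delta S M (refl_s M s \<beta>) = cls (conj_word (s # ws) [Inl t])"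
    using delta_eq[of "s # ws" t] ws assms(2) by simp
  moreover have "conj_word (s # ws) [Inl t] = ([Inr s] @ conj_word ws [Inl t]) @ [Inr s]"
    by (simp add: conj_word_def)
  ultimately show ?thesis
    unfolding ws(3) delta_eq[OF ws(1,2)] by (simp only: cls_mult)
qed

text \<open>Letters are absorbed one at a time from the left: a sigma letter is the element of a
  simple root or its inverse, and a tau letter passes through \<open>g\<close> by conjugation, which
  preserves the generated subgroup.\<close>

lemma VA_factorization:
  assumes "u \<in> lists (va_gens S \<times> UNIV)"
  shows "\<exists>g \<in> generate VA (delta S M ` \<Phi>). \<exists>w \<in> lists (S \<times> UNIV).
    pres_class VR u = g \<otimes>\<^bsub>VA\<^esub> pres_class VR (map (apfst Inr) w)"
  using assms
proof (induction u)
  case Nil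
  interpret VA: group VA by (rule group_VA)
  have "pres_class VR [] = \<one>\<^bsub>VA\<^esub>" by (simp add: va_group_def pres_one)
  then show ?case
    by (intro bexI[OF _ generate.one] bexI[of _ "[]"]) simp_all
next
  case (Cons x u)
  interpret VA: group VA by (rule group_VA)
  let ?H = "generate VA (delta S M ` \<Phi>)"
  have D: "delta S M ` \<Phi> \<subseteq> carrier VA" using delta_in_carrier by blast
  obtain y b where x: "x = (y, b)" by force
  obtain g w where g: "g \<in> ?H" and w: "w \<in> lists (S \<times> UNIV)"
    and u: "pres_class VR u = g \<otimes>\<^bsub>VA\<^esub> pres_class VR (map (apfst Inr) w)"
    using Cons by auto
  let ?t = "pres_class VR (map (apfst Inr) w)"
  have gc: "g \<in> carrier VA" using VA.generate_in_carrier[OF D g] .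
  have tc: "?t \<in> carrier VA" using w
    by (auto simp: va_group_def va_gens_def intro!: pres_class_in_carrier map_apfst_in_lists[of _ S])
  have xu: "pres_class VR (x # u) = pres_class VR [(y, b)] \<otimes>\<^bsub>VA\<^esub> (g \<otimes>\<^bsub>VA\<^esub> ?t)"
    unfolding u[symmetric] by (simp add: x va_group_def pres_mult)
  have y: "y \<in> va_gens S" using Cons x by simp
  then have yc: "pres_class VR [(y, b)] \<in> carrier VA"
    by (simp add: va_group_def pres_class_in_carrier)
  show ?case
  proof (cases y)
    case (Inl s)
    then have s: "s \<in> S" using y by (auto simp: va_gens_def)
    have d: "delta S M (alpha s) = pres_class VR [(Inl s, True)]"
      using delta_eq[of "[]" s] s by (simp add: conj_word_def cls_def)
    have "inv\<^bsub>VA\<^esub> (pres_class VR [(Inl s, True)]) = pres_class VR (inv_word [(Inl s, True)])"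
      unfolding va_group_def using y Inl by (intro pres_inv) simp
    then have "pres_class VR [(y, b)] = (if b then delta S M (alpha s) else inv\<^bsub>VA\<^esub> (delta S M (alpha s)))"
      by (simp add: Inl d inv_word_def)
    then have "pres_class VR [(y, b)] \<in> ?H"
      using alpha_in_root_system[OF s] by (simp add: generate.incl generate.inv)
    then have "pres_class VR [(y, b)] \<otimes>\<^bsub>VA\<^esub> g \<in> ?H" using g by (rule generate.eng)
    then show ?thesis using w gc tc yc xu VA.m_assoc by metis
  next
    case (Inr s)
    then have s: "s \<in> S" using y by (auto simp: va_gens_def)
    let ?r = "cls [Inr s]"
    have "([(Inr s, b)], [(Inr s, True)]) \<in> pres_rel VR"
      using tau_veq[OF ceq_square[OF s, of "[]" "[]"]] by (intro pres_rel_letter_sign) (simp add: veq_def)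
    then have r: "pres_class VR [(y, b)] = ?r" by (simp add: cls_def Inr pres_class_eq_iff)
    have "?r \<otimes>\<^bsub>VA\<^esub> d \<otimes>\<^bsub>VA\<^esub> inv\<^bsub>VA\<^esub> ?r \<in> ?H" if "d \<in> delta S M ` \<Phi>" for d
      using that s by (auto simp: tau_conj_delta refl_s_root_system intro!: generate.incl)
    then have conj: "?r \<otimes>\<^bsub>VA\<^esub> g \<otimes>\<^bsub>VA\<^esub> inv\<^bsub>VA\<^esub> ?r \<in> ?H"
      using VA.generate_conj_closed[OF D _ _ g, of ?r] yc r by simp
    have "?r \<otimes>\<^bsub>VA\<^esub> ?t = pres_class VR (map (apfst Inr) ((s, True) # w))"
      by (simp add: cls_def va_group_def pres_mult)
    moreover have "pres_class VR (x # u) = (?r \<otimes>\<^bsub>VA\<^esub> g \<otimes>\<^bsub>VA\<^esub> inv\<^bsub>VA\<^esub> ?r) \<otimes>\<^bsub>VA\<^esub> (?r \<otimes>\<^bsub>VA\<^esub> ?t)"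
      using gc tc yc unfolding xu r
      by (simp add: VA.m_assoc VA.inv_solve_left flip: VA.m_assoc[of "inv\<^bsub>VA\<^esub> ?r" ?r ?t])
    moreover have "(s, True) # w \<in> lists (S \<times> UNIV)" using s w by simp
    ultimately show ?thesis using conj by metis
  qed
qed

text \<open>\<open>pi_K\<close> sends the tau word of \<open>w\<close> back to the class of
  \<open>w\<close> and kills the other factor. For an element of the kernel the class of
  \<open>w\<close> is therefore trivial, hence so is its tau word, and only the factor in the
  generated subgroup remains.\<close>

lemma KVA_generate: "KVA S M = generate VA (delta S M ` \<Phi>)"
proof
  interpret pi: group_hom VA W "pi_K S M" by (rule pi_K_hom)
  let ?H = "generate VA (delta S M ` \<Phi>)"
  show incl: "?H \<subseteq> KVA S M"
    using delta_in_KVA pi.subgroup_kernel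
    by (intro group.generate_subgroup_incl[OF group_VA]) (auto simp: KVA_def)
  show "KVA S M \<subseteq> ?H"
  proof
    fix x assume x: "x \<in> KVA S M"
    then have "x \<in> carrier VA" "pi_K S M x = \<one>\<^bsub>W\<^esub>" by (auto simp: KVA_def kernel_def)
    then obtain u where "u \<in> lists (va_gens S \<times> UNIV)" "x = pres_class VR u"
      by (auto simp: va_group_def pres_carrier)
    then obtain g w where g: "g \<in> ?H" and w: "w \<in> lists (S \<times> UNIV)"
      and xg: "x = g \<otimes>\<^bsub>VA\<^esub> pres_class VR (map (apfst Inr) w)"
      using VA_factorization by blast
    let ?t = "pres_class VR (map (apfst Inr) w)"
    have tc: "?t \<in> carrier VA" using w
      by (auto simp: va_group_def va_gens_def intro!: pres_class_in_carrier map_apfst_in_lists[of _ S])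
    have gK: "g \<in> carrier VA" "pi_K S M g = \<one>\<^bsub>W\<^esub>" using g incl by (auto simp: KVA_def kernel_def)
    have "pres_class CR w \<in> carrier W" using w by (simp add: coxeter_group_def pres_class_in_carrier)
    then have "pres_class CR w = \<one>\<^bsub>W\<^esub>"
      using \<open>pi_K S M x = \<one>\<^bsub>W\<^esub>\<close> gK tc w by (simp add: xg pi_K_tau)
    then have "(w, []) \<in> pres_rel CR" by (simp add: coxeter_group_def pres_one pres_class_eq_iff)
    then have "?t = \<one>\<^bsub>VA\<^esub>"
      using tau_rel_word[of w "[]"] by (simp add: va_group_def pres_one pres_class_eq_iff)
    then show "x \<in> ?H" using g gK xg by simp
  qed
qed

lemma KVA_artin:
  "\<exists>h. h \<in> iso (artin_group \<Phi> (hat_M S M)) (VA\<lparr>carrier := KVA S M\<rparr>)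
     \<and> (\<forall>\<beta>\<in>\<Phi>. h (pres_gen HR \<beta>) = delta S M \<beta>)"
proof -
  interpret VA: group VA by (rule group_VA)
  define h where "h = pres_lift \<Phi> VA (delta S M)"
  note lift = delta_in_carrier artin_rels_lists[of \<Phi> "hat_M S M"] eval_delta_artin_rels
  have h_class: "h (pres_class HR w) = eval_word VA (delta S M) w" if "w \<in> lists (\<Phi> \<times> UNIV)" for w
    unfolding h_def using lift that by (rule VA.pres_lift_class)
  have h_hom: "h \<in> hom (artin_group \<Phi> (hat_M S M)) VA"
    unfolding h_def artin_group_def using lift by (rule VA.pres_lift_hom)
  have carr: "carrier (artin_group \<Phi> (hat_M S M)) = pres_class HR ` lists (\<Phi> \<times> UNIV)"
    by (simp add: artin_group_def pres_carrier)
  have "h ` carrier (artin_group \<Phi> (hat_M S M)) = eval_word VA (delta S M) ` lists (\<Phi> \<times> UNIV)"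
    unfolding carr image_image using h_class by (intro image_cong HOL.refl)
  also have "\<dots> = KVA S M"
    unfolding KVA_generate using VA.generate_eq_eval_word[OF delta_in_carrier] by simp
  finally have img: "h ` carrier (artin_group \<Phi> (hat_M S M)) = KVA S M" .
  have "inj_on h (carrier (artin_group \<Phi> (hat_M S M)))"
    unfolding carr using h_class eval_delta_inj by (auto simp: inj_on_def pres_class_eq_iff)
  then have "bij_betw h (carrier (artin_group \<Phi> (hat_M S M))) (carrier (VA\<lparr>carrier := KVA S M\<rparr>))"
    using img by (simp add: bij_betw_def)
  moreover have "h \<in> hom (artin_group \<Phi> (hat_M S M)) (VA\<lparr>carrier := KVA S M\<rparr>)"
    using h_hom img by (auto simp: hom_def)
  moreover have "h (pres_gen HR \<beta>) = delta S M \<beta>" if "\<beta> \<in> \<Phi>" for \<beta>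
    unfolding h_def using lift that by (rule VA.pres_lift_gen)
  ultimately show ?thesis unfolding iso_def by blast
qed

end

theorem theorem2p3:
  fixes S :: "'s set" and M :: "'s \<Rightarrow> 's \<Rightarrow> enat"
  assumes "countable S" and "coxeter_matrix S M"
  shows "\<exists>h. h \<in> iso (artin_group (root_system S M) (hat_M S M))
                    ((va_group S M)\<lparr>carrier := KVA S M\<rparr>)
           \<and> (\<forall>\<beta>\<in>root_system S M.
                 h (pres_gen (artin_rels (root_system S M) (hat_M S M)) \<beta>) = delta S M \<beta>)
           \<and> KVA S M = generate (va_group S M) (delta S M ` root_system S M)"
proof -
  interpret coxeter S M using assms(2) by unfold_locales
  show ?thesis using KVA_artin KVA_generate by blast
qed

end
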